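(* Let $\underline\delta=(\delta_0,\delta,\ldots,\delta,\delta_n)\in(\mathbb{C}^* )^{n+1}$ and fix $\beta_0,\beta_1\in\mathbb{C}^*$. There exists a unique algebra homomorphism $\omega=\omega^{\underline\delta}_{\beta_0,\beta_1}:\mathrm{TL}(\underline\delta)\to\mathrm{End}_{\mathbb{C}}(\mathbb{C}[\mathcal M])$ such that, writing $e_j\mathfrak p:=\omega(e_j)\mathfrak p$ for $\mathfrak p\in\mathcal M$: for $1\le i<n$, $$e_i\mathfrak p=\begin{cases}\delta\,\mathfrak p & m_i(\mathfrak p)=i+1,\\ \delta_0^{\mathrm{pty}(i-1)}(\mathfrak p_i\cup\{\{i,i+1\}\}) & m_i(\mathfrak p)=0=m_{i+1}(\mathfrak p),\\ \delta_n^{\mathrm{pty}(n+1-i)}(\mathfrak p_i\cup\{\{i,i+1\}\}) & m_i(\mathfrak p)=n+1=m_{i+1}(\mathfrak p),\\ \beta_{\mathrm{pty}(i)}(\mathfrak p_i\cup\{\{i,i+1\}\}) & m_i(\mathfrak p)=0,\ m_{i+1}(\mathfrak p)=n+1,\\ \mathfrak p_i\cup\{\{i,i+1\},\{m_i(\mathfrak p),m_{i+1}(\mathfrak p)\}\} & \text{otherwise};\end{cases}$$ $$e_0\mathfrak p=\begin{cases}\delta_0\mathfrak p & m_1(\mathfrak p)=0,\\ \beta_0(\mathfrak p_0\cup\{\{0,1\}\}) & m_1(\mathfrak p)=n+1,\\ \mathfrak p_0\cup\{\{0,1\},\{0,m_1(\mathfrak p)\}\} & \text{otherwise};\end{cases}\qquad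 e_n\mathfrak p=\begin{cases}\delta_n\mathfrak p & m_n(\mathfrak p)=n+1,\\ \beta_{\mathrm{pty}(n)}(\mathfrak p_n\cup\{\{n,n+1\}\}) & m_n(\mathfrak p)=0,\\ \mathfrak p_n\cup\{\{n,n+1\},\{m_n(\mathfrak p),n+1\}\} & \text{otherwise}.\end{cases}$$
   Context: $\mathrm{TL}(\underline\delta)$ is the unital complex algebra with generators $e_0,\ldots,e_n$ and relations $e_i^2=\delta_ie_i$ ($0\le i\le n$, $\delta_i=\delta$ for $1\le i<n$), $e_ie_{i\pm1}e_i=e_i$ ($1\le i<n$), $e_ie_j=e_je_i$ ($|i-j|>1$). Let $[n+1]=\{0,1,\ldots,n+1\}$ and $\mathcal S$ the set of unordered pairs $\{i,j\}$, $i\ne j$, in $[n+1]$. A two-boundary non-crossing perfect matching is a subset $\mathfrak p\subseteq\mathcal S$ such that (1) each $i\in\{1,\ldots,n\}$ lies in exactly one pair of $\mathfrak p$; (2) there are no $\{i,j\},\{k,l\}\in\mathfrak p$ with $i<k<j<l$; (3) $\{0,n+1\}\notin\mathfrak p$ (the points $0,n+1$ may lie in several or no pairs). $\mathcal M$ is the set of these, and $\mathbb{C}[\mathcal M]$ the complex vector space with basis $\mathcal M$. For $\mathfrak p\in\mathcal M$ and $1\le i\le n$, $m_i(\mathfrak p)$ is the unique $j$ with $\{i,j\}\in\mathfrak p$. For $1\le i<n$, $\mathfrak p_i$ is $\mathfrak p$ with all pairs containing $i$ or $i+1$ removed; $\mathfrak p_0$ (resp. $\mathfrak p_n$) is $\mathfrak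 p$ with the pair containing $1$ (resp. $n$) removed. $\mathrm{pty}(i)=0$ for $i$ even, $1$ for $i$ odd. *)

theory Defs
  imports Complex_Main
begin

definition S_pairs :: "nat \<Rightarrow> nat set set" where
  "S_pairs n = {{i, j} | i j. i \<noteq> j \<and> i \<le> n + 1 \<and> j \<le> n + 1}"

definition matchings :: "nat \<Rightarrow> nat set set set" where
  "matchings n = {p. p \<subseteq> S_pairs n
      \<and> (\<forall>i. 1 \<le> i \<and> i \<le> n \<longrightarrow> (\<exists>!q. q \<in> p \<and> i \<in> q))
      \<and> \<not> (\<exists>i j k l. {i, j} \<in> p \<and> {k, l} \<in> p \<and> i < k \<and> k < j \<and> j < l)
      \<and> {0, n + 1} \<notin> p}"

definition mate :: "nat set set \<Rightarrow> nat \<Rightarrow> nat" where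
  "mate p i = (THE j. {i, j} \<in> p)"

definition rem_i :: "nat set set \<Rightarrow> nat \<Rightarrow> nat set set" where
  "rem_i p i = {q \<in> p. i \<notin> q \<and> i + 1 \<notin> q}"

definition rem_0 :: "nat set set \<Rightarrow> nat set set" where
  "rem_0 p = {q \<in> p. 1 \<notin> q}"

definition rem_n :: "nat \<Rightarrow> nat set set \<Rightarrow> nat set set" where
  "rem_n n p = {q \<in> p. n \<notin> q}"

definition pty :: "nat \<Rightarrow> nat" where
  "pty i = (if even i then 0 else 1)"

definition beta :: "complex \<Rightarrow> complex \<Rightarrow> nat \<Rightarrow> complex" where
  "beta \<beta>0 \<beta>1 k = (if k = 0 then \<beta>0 else \<beta>1)"

type_synonym cvec = "nat set set \<Rightarrow> complex"

definition Vsp :: "nat \<Rightarrow> cvec set" where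
  "Vsp n = {v. \<forall>p. v p \<noteq> 0 \<longrightarrow> p \<in> matchings n}"

definition basis_vec :: "nat set set \<Rightarrow> cvec" where
  "basis_vec p = (\<lambda>q. if q = p then 1 else 0)"

definition vsmult :: "complex \<Rightarrow> cvec \<Rightarrow> cvec" where
  "vsmult c v = (\<lambda>q. c * v q)"

definition vadd :: "cvec \<Rightarrow> cvec \<Rightarrow> cvec" where
  "vadd u v = (\<lambda>q. u q + v q)"

text \<open>An element of End(C[M]) is a C-linear map of C[M] into itself; such maps are
  compared only on C[M] (values outside C[M] are irrelevant).\<close>

definition is_End :: "nat \<Rightarrow> (cvec \<Rightarrow> cvec) \<Rightarrow> bool" where
  "is_End n f \<longleftrightarrow> (\<forall>v \<in> Vsp n. f v \<in> Vsp n)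
     \<and> (\<forall>u \<in> Vsp n. \<forall>v \<in> Vsp n. f (vadd u v) = vadd (f u) (f v))
     \<and> (\<forall>c. \<forall>v \<in> Vsp n. f (vsmult c v) = vsmult c (f v))"

text \<open>Elements of the free algebra: finitely supported functions from words
  (lists of generator indices in {0..n}) to complex numbers.\<close>

type_synonym fa = "nat list \<Rightarrow> complex"

definition FA :: "nat \<Rightarrow> fa set" where
  "FA n = {a. finite {w. a w \<noteq> 0} \<and> (\<forall>w. a w \<noteq> 0 \<longrightarrow> set w \<subseteq> {0..n})}"

definition fa_zero :: fa where "fa_zero = (\<lambda>w. 0)"
definition fa_one :: fa where "fa_one = (\<lambda>w. if w = [] then 1 else 0)"
definition fa_gen :: "nat \<Rightarrow> fa" where "fa_gen i = (\<lambda>w. if w = [i] then 1 else 0)"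
definition fa_add :: "fa \<Rightarrow> fa \<Rightarrow> fa" where "fa_add a b = (\<lambda>w. a w + b w)"
definition fa_diff :: "fa \<Rightarrow> fa \<Rightarrow> fa" where "fa_diff a b = (\<lambda>w. a w - b w)"
definition fa_smult :: "complex \<Rightarrow> fa \<Rightarrow> fa" where "fa_smult c a = (\<lambda>w. c * a w)"
definition fa_mult :: "fa \<Rightarrow> fa \<Rightarrow> fa" where
  "fa_mult a b = (\<lambda>w. \<Sum>k\<in>{0..length w}. a (take k w) * b (drop k w))"

definition dlt :: "nat \<Rightarrow> complex \<Rightarrow> complex \<Rightarrow> complex \<Rightarrow> nat \<Rightarrow> complex" where
  "dlt n \<delta>0 \<delta> \<delta>n i = (if i = 0 then \<delta>0 else if i = n then \<delta>n else \<delta>)"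

definition TL_rels :: "nat \<Rightarrow> complex \<Rightarrow> complex \<Rightarrow> complex \<Rightarrow> fa set" where
  "TL_rels n \<delta>0 \<delta> \<delta>n =
     {fa_diff (fa_mult (fa_gen i) (fa_gen i)) (fa_smult (dlt n \<delta>0 \<delta> \<delta>n i) (fa_gen i)) | i. i \<le> n}
   \<union> {fa_diff (fa_mult (fa_mult (fa_gen i) (fa_gen j)) (fa_gen i)) (fa_gen i) | i j.
        1 \<le> i \<and> i < n \<and> (j = i + 1 \<or> j + 1 = i)}
   \<union> {fa_diff (fa_mult (fa_gen i) (fa_gen j)) (fa_mult (fa_gen j) (fa_gen i)) | i j.
        i \<le> n \<and> j \<le> n \<and> (i + 1 < j \<or> j + 1 < i)}"

inductive_set TL_ideal :: "nat \<Rightarrow> complex \<Rightarrow> complex \<Rightarrow> complex \<Rightarrow> fa set"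
  for n \<delta>0 \<delta> \<delta>n where
  zero: "fa_zero \<in> TL_ideal n \<delta>0 \<delta> \<delta>n"
| step: "\<lbrakk>r \<in> TL_rels n \<delta>0 \<delta> \<delta>n; a \<in> FA n; b \<in> FA n; x \<in> TL_ideal n \<delta>0 \<delta> \<delta>n\<rbrakk>
         \<Longrightarrow> fa_add (fa_mult (fa_mult a r) b) x \<in> TL_ideal n \<delta>0 \<delta> \<delta>n"

definition TL_cong :: "nat \<Rightarrow> complex \<Rightarrow> complex \<Rightarrow> complex \<Rightarrow> (fa \<times> fa) set" where
  "TL_cong n \<delta>0 \<delta> \<delta>n = {(x, y). x \<in> FA n \<and> y \<in> FA n \<and> fa_diff x y \<in> TL_ideal n \<delta>0 \<delta> \<delta>n}"

definition TL :: "nat \<Rightarrow> complex \<Rightarrow> complex \<Rightarrow> complex \<Rightarrow> fa set set" where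
  "TL n \<delta>0 \<delta> \<delta>n = FA n // TL_cong n \<delta>0 \<delta> \<delta>n"

definition cls :: "nat \<Rightarrow> complex \<Rightarrow> complex \<Rightarrow> complex \<Rightarrow> fa \<Rightarrow> fa set" where
  "cls n \<delta>0 \<delta> \<delta>n x = TL_cong n \<delta>0 \<delta> \<delta>n `` {x}"

text \<open>Algebra homomorphisms TL(delta) -> End(C[M]); the operations of the quotient
  algebra are those induced by representatives.\<close>

definition is_TL_hom :: "nat \<Rightarrow> complex \<Rightarrow> complex \<Rightarrow> complex \<Rightarrow> (fa set \<Rightarrow> cvec \<Rightarrow> cvec) \<Rightarrow> bool" where
  "is_TL_hom n \<delta>0 \<delta> \<delta>n \<omega> \<longleftrightarrow>
     (\<forall>X \<in> TL n \<delta>0 \<delta> \<delta>n. is_End n (\<omega> X))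
   \<and> (\<forall>x \<in> FA n. \<forall>y \<in> FA n. \<forall>v \<in> Vsp n.
        \<omega> (cls n \<delta>0 \<delta> \<delta>n (fa_add x y)) v = vadd (\<omega> (cls n \<delta>0 \<delta> \<delta>n x) v) (\<omega> (cls n \<delta>0 \<delta> \<delta>n y) v))
   \<and> (\<forall>c. \<forall>x \<in> FA n. \<forall>v \<in> Vsp n.
        \<omega> (cls n \<delta>0 \<delta> \<delta>n (fa_smult c x)) v = vsmult c (\<omega> (cls n \<delta>0 \<delta> \<delta>n x) v))
   \<and> (\<forall>x \<in> FA n. \<forall>y \<in> FA n. \<forall>v \<in> Vsp n.
        \<omega> (cls n \<delta>0 \<delta> \<delta>n (fa_mult x y)) v = \<omega> (cls n \<delta>0 \<delta> \<delta>n x) (\<omega> (cls n \<delta>0 \<delta> \<delta>n y) v))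
   \<and> (\<forall>v \<in> Vsp n. \<omega> (cls n \<delta>0 \<delta> \<delta>n fa_one) v = v)"

definition act_i :: "nat \<Rightarrow> complex \<Rightarrow> complex \<Rightarrow> complex \<Rightarrow> complex \<Rightarrow> complex
    \<Rightarrow> nat \<Rightarrow> nat set set \<Rightarrow> cvec" where
  "act_i n \<delta>0 \<delta> \<delta>n \<beta>0 \<beta>1 i p =
    (if mate p i = i + 1 then vsmult \<delta> (basis_vec p)
     else if mate p i = 0 \<and> mate p (i + 1) = 0 then
       vsmult (\<delta>0 ^ pty (i - 1)) (basis_vec (rem_i p i \<union> {{i, i + 1}}))
     else if mate p i = n + 1 \<and> mate p (i + 1) = n + 1 then
       vsmult (\<delta>n ^ pty (n + 1 - i)) (basis_vec (rem_i p i \<union> {{i, i + 1}}))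
     else if mate p i = 0 \<and> mate p (i + 1) = n + 1 then
       vsmult (beta \<beta>0 \<beta>1 (pty i)) (basis_vec (rem_i p i \<union> {{i, i + 1}}))
     else basis_vec (rem_i p i \<union> {{i, i + 1}, {mate p i, mate p (i + 1)}}))"

definition act_0 :: "nat \<Rightarrow> complex \<Rightarrow> complex \<Rightarrow> nat set set \<Rightarrow> cvec" where
  "act_0 n \<delta>0 \<beta>0 p =
    (if mate p 1 = 0 then vsmult \<delta>0 (basis_vec p)
     else if mate p 1 = n + 1 then vsmult \<beta>0 (basis_vec (rem_0 p \<union> {{0, 1}}))
     else basis_vec (rem_0 p \<union> {{0, 1}, {0, mate p 1}}))"

definition act_n :: "nat \<Rightarrow> complex \<Rightarrow> complex \<Rightarrow> complex \<Rightarrow> nat set set \<Rightarrow> cvec" where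
  "act_n n \<delta>n \<beta>0 \<beta>1 p =
    (if mate p n = n + 1 then vsmult \<delta>n (basis_vec p)
     else if mate p n = 0 then vsmult (beta \<beta>0 \<beta>1 (pty n)) (basis_vec (rem_n n p \<union> {{n, n + 1}}))
     else basis_vec (rem_n n p \<union> {{n, n + 1}, {mate p n, n + 1}}))"

definition acts_as_prescribed :: "nat \<Rightarrow> complex \<Rightarrow> complex \<Rightarrow> complex \<Rightarrow> complex \<Rightarrow> complex
    \<Rightarrow> (fa set \<Rightarrow> cvec \<Rightarrow> cvec) \<Rightarrow> bool" where
  "acts_as_prescribed n \<delta>0 \<delta> \<delta>n \<beta>0 \<beta>1 \<omega> \<longleftrightarrow>
    (\<forall>p \<in> matchings n.
       (\<forall>i. 1 \<le> i \<and> i < n \<longrightarrow>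
          \<omega> (cls n \<delta>0 \<delta> \<delta>n (fa_gen i)) (basis_vec p) = act_i n \<delta>0 \<delta> \<delta>n \<beta>0 \<beta>1 i p)
     \<and> \<omega> (cls n \<delta>0 \<delta> \<delta>n (fa_gen 0)) (basis_vec p) = act_0 n \<delta>0 \<beta>0 p
     \<and> \<omega> (cls n \<delta>0 \<delta> \<delta>n (fa_gen n)) (basis_vec p) = act_n n \<delta>n \<beta>0 \<beta>1 p)"

end

theory Submission
  imports Defs
begin

text \<open>
  Encode a matching by its mate function on 1, ..., n. Each generator then acts monomially: it sends
  a matching to a scalar times one matching, the latter obtained by a uniform update of the mate
  function. The defining relations therefore split into identities of mate functions and identities of
  scalars. After \<open>e\<^sub>i\<close> has been applied, i and i + 1 are mated, so in \<open>e\<^sub>i\<^sup>2\<close> and \<open>e\<^sub>i e\<^sub>j e\<^sub>i\<close> all further scalars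
  are explicit. The commutation relations are clear unless an arc of the matching joins the two pairs
  {i, i + 1} and {j, j + 1}; two such arcs close a loop in either order, and by
  non-crossing a single one matters only if it joins i + 1 and j; these have opposite parity, which makes
  the parity-dependent weights agree.
  The action thus factors through the quotient of the free algebra. Uniqueness holds because the
  generators generate and the matchings span.
\<close>

section \<open>Mate functions and gluing\<close>

text \<open>Composing two generators on sets of pairs nests removals and insertions, and pairs
  vanish at the boundary. On functions the updates compose pointwise: once the mates of the at most
  four affected points are named, an identity of matchings is a finite case check. The parity
  weights are what the relations dictate. The exponent of \<delta>0 is 0 at i = 1, because
  \<open>e\<^sub>1 e\<^sub>0 e\<^sub>1 = e\<^sub>1\<close>, and 1 at i = 2, because
  \<open>e\<^sub>0 e\<^sub>2 = e\<^sub>2 e\<^sub>0\<close> on a matching containing {1, 2} and {0,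
  3}. Commuting \<open>e\<^sub>i\<close> and \<open>e\<^sub>j\<close> through an arc {i + 1, j}
  links i to j, of equal parity. The exponent of \<delta>n is the mirror image, counted from n + 1,
  and \<open>e\<^sub>0\<close> links \<beta>0 to the even indices. All other arcs joining the two
  pairs are harmless for one reason: an arc ending at a further point of a pair encloses a point of
  that pair or of the other one, whose mate is then interior, so no boundary weight arises.\<close>

text \<open>
  Mate functions encode two-boundary matchings: only the points 1, ..., n carry information, and
  the value 0 elsewhere is a normalisation that makes the encoding injective. The last clause is
  equivalent to non-crossing; it covers pairs containing n + 1 and, through its contrapositive
  (a pair enclosing l from the left prevents m l = 0), pairs containing 0.
\<close>

definition mate_fun :: "nat \<Rightarrow> (nat \<Rightarrow> nat) \<Rightarrow> bool" where
  "mate_fun n m \<longleftrightarrow>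
     (\<forall>k. k < 1 \<or> n < k \<longrightarrow> m k = 0) \<and>
     (\<forall>k. 1 \<le> k \<and> k \<le> n \<longrightarrow> m k \<le> n + 1 \<and> m k \<noteq> k) \<and>
     (\<forall>k. 1 \<le> k \<and> k \<le> n \<and> 1 \<le> m k \<and> m k \<le> n \<longrightarrow> m (m k) = k) \<and>
     (\<forall>k l. 1 \<le> k \<and> k < l \<and> l < m k \<longrightarrow> k < m l \<and> m l \<le> m k)"

text \<open>
  The matching part of the action of \<open>e\<^sub>i\<close>. The case distinctions of the statement disappear here:
  when the mates of i and i + 1 are boundary points, no interior point is mated to i or i + 1, so nothing
  else is redirected.
\<close>

definition glue :: "nat \<Rightarrow> nat \<Rightarrow> (nat \<Rightarrow> nat) \<Rightarrow> nat \<Rightarrow> nat" where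
  "glue n i m k =
     (if i = 0 then (if k = 1 \<or> m k = 1 then 0 else m k)
      else if i = n then (if k = n \<or> m k = n then n + 1 else m k)
      else if k = i then i + 1 else if k = i + 1 then i
      else if m k = i then m (i + 1) else if m k = i + 1 then m i else m k)"

definition coef :: "nat \<Rightarrow> complex \<Rightarrow> complex \<Rightarrow> complex \<Rightarrow> complex \<Rightarrow> complex
    \<Rightarrow> nat \<Rightarrow> (nat \<Rightarrow> nat) \<Rightarrow> complex" where
  "coef n \<delta>0 \<delta> \<delta>n \<beta>0 \<beta>1 i m =
     (if i = 0 then (if m 1 = 0 then \<delta>0 else if m 1 = n + 1 then \<beta>0 else 1)
      else if i = n then (if m n = n + 1 then \<delta>n else if m n = 0 then beta \<beta>0 \<beta>1 (pty n) else 1)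
      else if m i = i + 1 then \<delta>
      else if m i = 0 \<and> m (i + 1) = 0 then \<delta>0 ^ pty (i - 1)
      else if m i = n + 1 \<and> m (i + 1) = n + 1 then \<delta>n ^ pty (n + 1 - i)
      else if m i = 0 \<and> m (i + 1) = n + 1 then beta \<beta>0 \<beta>1 (pty i)
      else 1)"

text \<open>The default value 0 outside 1, ..., n absorbs the range guards of the definition. Only
  \<open>m k \<noteq> k\<close> keeps one, since m 0 = 0.\<close>

lemma mate_funD:
  assumes "mate_fun n m"
  shows "\<And>k. k < 1 \<or> n < k \<Longrightarrow> m k = 0"
    and "\<And>k. m k \<le> n + 1"
    and "\<And>k. 1 \<le> k \<Longrightarrow> m k \<noteq> k"
    and "\<And>k. 1 \<le> m k \<Longrightarrow> m k \<le> n \<Longrightarrow> m (m k) = k"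
    and "\<And>k l. 1 \<le> k \<Longrightarrow> k < l \<Longrightarrow> l < m k \<Longrightarrow> k < m l \<and> m l \<le> m k"
proof -
  have d1: "\<forall>k. k < 1 \<or> n < k \<longrightarrow> m k = 0"
    and d2: "\<forall>k. 1 \<le> k \<and> k \<le> n \<longrightarrow> m k \<le> n + 1 \<and> m k \<noteq> k"
    and d3: "\<forall>k. 1 \<le> k \<and> k \<le> n \<and> 1 \<le> m k \<and> m k \<le> n \<longrightarrow> m (m k) = k"
    and d4: "\<forall>k l. 1 \<le> k \<and> k < l \<and> l < m k \<longrightarrow> k < m l \<and> m l \<le> m k"
    using assms unfolding mate_fun_def by - (elim conjE, assumption)+
  show "m k = 0" if "k < 1 \<or> n < k" for k using d1[rule_format, OF that] .
  have out: "1 \<le> k \<and> k \<le> n \<or> m k = 0" for k using d1[rule_format, of k] by linarith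
  show "m k \<le> n + 1" for k using d2[rule_format, of k] out[of k] by auto
  show "m k \<noteq> k" if "1 \<le> k" for k using d2[rule_format, of k] out[of k] that by auto
  show "m (m k) = k" if "1 \<le> m k" "m k \<le> n" for k
    using d3[rule_format, of k] out[of k] that by linarith
  show "k < m l \<and> m l \<le> m k" if "1 \<le> k" "k < l" "l < m k" for k l
    using d4[rule_format, of k l] that by simp
qed

section \<open>Gluing preserves non-crossing mate functions\<close>

lemma mate_fun_mem_range: "mate_fun n m \<Longrightarrow> m k = l \<Longrightarrow> 1 \<le> l \<Longrightarrow> 1 \<le> k \<and> k \<le> n"
  using mate_funD(1)[of n m k] by linarith

lemma mate_fun_swap:
  "mate_fun n m \<Longrightarrow> m k = l \<Longrightarrow> 1 \<le> l \<Longrightarrow> l \<le> n \<Longrightarrow> m l = k"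
  using mate_funD(4)[of n m k] by simp

text \<open>Redirecting values to 0 threatens only the lower bound in the non-crossing clause. A
  point l enclosed by k satisfies l > 1 and m l > k \<ge> 1, so it is not redirected.\<close>

lemma mate_fun_glue_0:
  assumes m: "mate_fun n m" and n: "1 \<le> n"
  shows "mate_fun n (glue n 0 m)"
proof -
  note f = mate_funD[OF m]
  have g: "glue n 0 m k = (if k = 1 \<or> m k = 1 then 0 else m k)" for k
    by (simp add: glue_def)
  show ?thesis unfolding mate_fun_def g
  proof (intro conjI allI impI)
    fix k l assume a: "1 \<le> k \<and> k < l \<and> l < (if k = 1 \<or> m k = 1 then 0 else m k)"
    then have "k < l" "l < m k" "1 \<le> k" by (auto split: if_splits)
    with f(5) have "k < m l" "m l \<le> m k" by blast+
    then show "k < (if l = 1 \<or> m l = 1 then 0 else m l)"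
      "(if l = 1 \<or> m l = 1 then 0 else m l) \<le> (if k = 1 \<or> m k = 1 then 0 else m k)" 
      using a by (auto split: if_splits)
  next
    fix k assume a: "1 \<le> k \<and> k \<le> n \<and> 1 \<le> (if k = 1 \<or> m k = 1 then 0 else m k) \<and> (if k = 1 \<or> m k = 1 then 0 else m k) \<le> n"
    then have k: "k \<noteq> 1" "m k \<noteq> 1" "1 \<le> m k" "m k \<le> n" by (auto split: if_splits)
    with f(4) have "m (m k) = k" by blast
    with k show "(if (if k = 1 \<or> m k = 1 then 0 else m k) = 1 \<or> m (if k = 1 \<or> m k = 1 then 0 else m k) = 1 then 0
          else m (if k = 1 \<or> m k = 1 then 0 else m k)) = k" by simp
  qed (use f(1-3) n in auto)
qed

text \<open>Redirected values become n + 1, so only the upper bound in the non-crossing clause is at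
  risk. If the enclosed point l is redirected, then m k \<ge> n; either m k = n + 1 already, or m k
  = n and k is redirected as well.\<close>

lemma mate_fun_glue_n:
  assumes m: "mate_fun n m" and n: "1 \<le> n"
  shows "mate_fun n (glue n n m)"
proof -
  note f = mate_funD[OF m]
  have g: "glue n n m k = (if k = n \<or> m k = n then n + 1 else m k)" for k
    using n by (simp add: glue_def)
  show ?thesis unfolding mate_fun_def
  proof (intro conjI allI impI)
    fix k l assume a: "1 \<le> k \<and> k < l \<and> l < glue n n m k"
    then have kn: "k < n" and ln: "l \<le> n" using f(2)[of k] by (auto simp: g split: if_splits)
    have nc: "l < m k \<Longrightarrow> k < m l \<and> m l \<le> m k" using f(5) a by blast
    have inj: "m l = n \<Longrightarrow> m n = l" "m k = n \<Longrightarrow> m n = k" using n by (auto intro: mate_fun_swap[OF m])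
    show "k < glue n n m l" "glue n n m l \<le> glue n n m k"
      using a kn ln nc inj f(2)[of k] f(2)[of l] unfolding g by (auto split: if_splits)
  next
    fix k assume a: "1 \<le> k \<and> k \<le> n \<and> 1 \<le> glue n n m k \<and> glue n n m k \<le> n"
    then have k: "k \<noteq> n" "m k \<noteq> n" "1 \<le> m k" "m k \<le> n" by (auto simp: g split: if_splits)
    with f(4) have "m (m k) = k" by blast
    with k show "glue n n m (glue n n m k) = k" by (simp add: g)
  qed (use f(1-3) n in \<open>auto simp: g\<close>)
qed

text \<open>The danger lies in the new arc {a, b} joining the old mates a of i and b of i + 1.
  Non-crossing leaves few shapes: the old arcs are side by side (a < i and i + 1 < b) or nested on
  one side (b < a < i or i + 1 < b < a). In each of them the new arc runs along the old ones, so
  what it encloses was already confined by them.\<close>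

lemma mate_fun_glue_mid:
  assumes m: "mate_fun n m" and i: "1 \<le> i" "i < n"
  shows "mate_fun n (glue n i m)"
proof -
  note f = mate_funD[OF m]
  define g where "g = glue n i m"
  obtain a b where a: "m i = a" and b: "m (i + 1) = b" by blast
  have g: "g k = (if k = i then i + 1 else if k = i + 1 then i
      else if m k = i then b else if m k = i + 1 then a else m k)" for k
    using i a b by (simp add: glue_def g_def)
  have sw: "m k = i \<Longrightarrow> k = a" "m k = i + 1 \<Longrightarrow> k = b" for k
    using mate_fun_swap[OF m, of k i] mate_fun_swap[OF m, of k "i + 1"] i a b by auto
  have iv: "1 \<le> a \<Longrightarrow> a \<le> n \<Longrightarrow> m a = i" "1 \<le> b \<Longrightarrow> b \<le> n \<Longrightarrow> m b = i + 1"
    using f(4)[of i] f(4)[of "i + 1"] a b by auto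
  have ab: "a \<noteq> i" "b \<noteq> i + 1" "a \<le> n + 1" "b \<le> n + 1" "a = i + 1 \<longleftrightarrow> b = i"
    using f(2,3)[of i] f(2,3)[of "i + 1"] a b iv i by auto
  have ab': "a \<noteq> b" if "1 \<le> a" "a \<le> n"
    using iv that by auto
  have ncab: "i + 1 < a \<Longrightarrow> i < b \<and> b \<le> a"
    and nci: "\<And>l. i < l \<Longrightarrow> l < a \<Longrightarrow> i < m l \<and> m l \<le> a"
    and nci': "\<And>l. i + 1 < l \<Longrightarrow> l < b \<Longrightarrow> i + 1 < m l \<and> m l \<le> b"
    and nck: "\<And>k. 1 \<le> k \<Longrightarrow> k < i \<Longrightarrow> i < m k \<Longrightarrow> k < a \<and> a \<le> m k"
    and nck': "\<And>k. 1 \<le> k \<Longrightarrow> k < i + 1 \<Longrightarrow> i + 1 < m k \<Longrightarrow> k < b \<and> b \<le> m k"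
    using f(5) a b i by force+
  show ?thesis unfolding mate_fun_def g_def[symmetric]
  proof (intro conjI allI impI)
    fix k assume "k < 1 \<or> n < k"
    then show "g k = 0" using f(1)[of k] i by (auto simp: g)
  next
    fix k assume "1 \<le> k \<and> k \<le> n"
    then show "g k \<le> n + 1" "g k \<noteq> k"
      using f(2)[of k] f(3)[of k] ab ab' sw[of k] i by (auto simp: g)
  next
    fix k assume k: "1 \<le> k \<and> k \<le> n \<and> 1 \<le> g k \<and> g k \<le> n"
    have "m k \<noteq> i \<Longrightarrow> m k \<noteq> i + 1 \<Longrightarrow> k \<noteq> i \<Longrightarrow> k \<noteq> i + 1 \<Longrightarrow> m (m k) = k"
      using k f(4)[of k] by (auto simp: g)
    then show "g (g k) = k" using k sw[of k] iv ab i
      by (auto simp: g split: if_splits)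
  next
    fix k l assume kl: "1 \<le> k \<and> k < l \<and> l < g k"
    have ki: "k \<noteq> i" "k \<noteq> i + 1" using kl by (auto simp: g)
    have "k < g l \<and> g l \<le> g k"
    proof (cases "l = i \<or> l = i + 1")
      case True then show ?thesis using kl ki by (auto simp: g)
    next
      case False
      then have gl: "g l = (if m l = i then b else if m l = i + 1 then a else m l)" by (simp add: g)
      have gk: "g k = (if m k = i then b else if m k = i + 1 then a else m k)" using ki by (simp add: g)
      consider "m k = i" | "m k = i + 1" | "m k \<noteq> i" "m k \<noteq> i + 1" by blast
      then show ?thesis
      proof cases
        \<comment> \<open>Here k = a < b: the old arcs {a, i} and {i + 1, b} lie side by side, and l
          is inside one of them.\<close>
        case 1
        then have "k = a" "g k = b" using sw gk by auto
        have mli: "m l \<noteq> i" using sw(1)[of l] \<open>k = a\<close> kl by auto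
        have mli': "m l \<noteq> i + 1" using sw(2)[of l] \<open>g k = b\<close> kl by auto
        have "k < i" using ncab kl ki \<open>k = a\<close> \<open>g k = b\<close> by linarith
        have "i + 1 < b"
        proof (rule ccontr)
          assume "\<not> i + 1 < b"
          then have "b < i" using ab \<open>k < i\<close> \<open>k = a\<close> by linarith
          then show False using f(5)[of k b] 1 iv(2) kl \<open>g k = b\<close> i by auto
        qed
        moreover have "l < i \<Longrightarrow> k < m l \<and> m l \<le> i" using f(5)[of k l] 1 kl by auto
        moreover have "l < i \<or> i + 1 < l" using False by auto
        moreover have "g l = m l" using gl mli mli' by simp
        ultimately show ?thesis using kl \<open>k < i\<close> nci'[of l] \<open>g k = b\<close> by linarith
      next
        \<comment> \<open>Here k = b < a: the old arcs are nested. For k < i the arc {a, i} lies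
          inside {b, i + 1}; for k > i + 1 the arc {i + 1, b} lies inside the arc from i to a. In
          both cases l lies in the gap between b and a, where no arc can escape.\<close>
        case 2
        then have "k = b" "g k = a" using sw gk by auto
        have mli: "m l \<noteq> i + 1" using sw(2)[of l] \<open>k = b\<close> kl by auto
        have mli': "m l \<noteq> i" using sw(1)[of l] \<open>g k = a\<close> kl by auto
        have gl: "g l = m l" using gl mli mli' by simp
        have ln: "l \<le> n" using kl \<open>g k = a\<close> ab by linarith
        show ?thesis
        proof (cases "k < i")
          case True
          then have "a \<le> i + 1" "k < a" using nck[of k] 2 kl by auto
          then have "a < i" using ab True \<open>k = b\<close> by linarith
          then have ml: "k < m l" "m l \<le> i + 1" using f(5)[of k l] 2 kl \<open>g k = a\<close> by auto
          have "m l \<le> a"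
          proof (rule ccontr)
            assume "\<not> m l \<le> a"
            then show False using f(5)[of l a] iv(1) kl \<open>g k = a\<close> ml mli mli' \<open>a < i\<close> i by auto
          qed
          then show ?thesis using ml gl \<open>g k = a\<close> by auto
        next
          case False
          then have "i + 1 < k" using ki by linarith
          then have ml: "i < m l" "m l \<le> a" using nci[of l] kl \<open>g k = a\<close> by auto
          have "k < m l"
          proof (rule ccontr)
            assume "\<not> k < m l"
            then have "m l \<le> k" "i + 1 < m l" using ml mli by auto
            moreover have "m (m l) = l" using f(4)[of l] calculation kl ln by auto
            moreover have "m l \<noteq> k" using calculation 2 kl \<open>i + 1 < k\<close> by auto
            ultimately show False using nci'[of "m l"] \<open>k = b\<close> kl by auto
          qed
          then show ?thesis using ml gl \<open>g k = a\<close> by auto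
        qed
      next
        \<comment> \<open>The arc at k keeps its end. If it encloses a point l mated to i or i + 1,
          it also encloses both i and i + 1, hence their mates a and b, one of which is the new
          value at l.\<close>
        case 3
        then have "g k = m k" using gk by auto
        then have "k < m l" "m l \<le> m k" using f(5)[of k l] kl by auto
        then show ?thesis
          using 3 \<open>g k = m k\<close> gl kl ki nck[of k] nck'[of k] by (cases "k < i") auto
      qed
    qed
    then show "k < g l" "g l \<le> g k" by auto
  qed
qed

lemma mate_fun_glue: "mate_fun n m \<Longrightarrow> 1 \<le> n \<Longrightarrow> i \<le> n \<Longrightarrow> mate_fun n (glue n i m)"
  using mate_fun_glue_0[of n m] mate_fun_glue_n[of n m] mate_fun_glue_mid[of n m i]
  by (cases "i = 0"; cases "i = n") auto

text \<open>
  An interval closed under mates has even length, so mated interior points have opposite parity.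
  This is what makes the scalars of two commuting generators match when an arc joins them.
\<close>

lemma even_closed_interval:
  assumes m: "mate_fun n m" and "1 \<le> k" "k \<le> l"
    and "\<And>x. k \<le> x \<Longrightarrow> x < l \<Longrightarrow> k \<le> m x \<and> m x < l"
    and "l \<le> n + 1"
  shows "even (l - k)"
  using assms(2-)
proof (induction "l - k" arbitrary: k l rule: less_induct)
  case less
  note f = mate_funD[OF m]
  show ?case
  proof (cases "k = l")
    case False
    \<comment> \<open>The arc from the leftmost point k cuts the interval into its interior and the
      part to its right. Both are closed under mates, and their lengths add up to the old length
      minus 2.\<close>
    define x where "x = m k"
    have x: "k < x" "x < l" "m x = k"
      using less.prems(1,2,4) less.prems(3)[of k] f(3)[of k] f(4)[of k] False unfolding x_def
      by auto
    have "even (x - (k + 1))"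
    proof (rule less.hyps)
      fix y assume y: "k + 1 \<le> y" "y < x"
      have "m y \<noteq> x" using x y f(4)[of y] less.prems by auto
      then show "k + 1 \<le> m y \<and> m y < x" using f(5)[of k y] y less.prems(1) unfolding x_def by auto
    qed (use x less.prems in auto)
    moreover have "even (l - (x + 1))"
    proof (rule less.hyps)
      fix y assume y: "x + 1 \<le> y" "y < l"
      have *: "k \<le> m y" "m y < l" using less.prems(3)[of y] y x by auto
      then have "m (m y) = y" using f(4)[of y] less.prems by auto
      moreover have "m y \<noteq> k" "m y \<noteq> x" using calculation y x by (auto simp: x_def)
      ultimately show "x + 1 \<le> m y \<and> m y < l"
        using f(5)[of k "m y"] * y less.prems(1) unfolding x_def by linarith
    qed (use x less.prems in auto)
    ultimately have "even (x - (k + 1) + (l - (x + 1)))" by simp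
    moreover have "l - k = x - (k + 1) + (l - (x + 1)) + 2" using x by auto
    ultimately show ?thesis by simp
  qed simp
qed

lemma mate_parity:
  assumes m: "mate_fun n m" and "1 \<le> k" "1 \<le> m k" "m k \<le> n"
  shows "even (m k) \<longleftrightarrow> odd k"
proof -
  note f = mate_funD[OF m]
  have *: "odd (y - x)" if "1 \<le> x" "x < y" "m x = y" "y \<le> n" for x y
  proof -
    have "m y = x" using that by (auto intro: mate_fun_swap[OF m])
    have "even (y - (x + 1))"
    proof (rule even_closed_interval[OF m])
      fix z assume z: "x + 1 \<le> z" "z < y"
      have "m z \<noteq> y" using \<open>m y = x\<close> z f(4)[of z] that by auto
      then show "x + 1 \<le> m z \<and> m z < y" using f(5)[of x z] z that by auto
    qed (use that in auto)
    moreover have "y - x = Suc (y - (x + 1))" using that by auto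
    ultimately show ?thesis by simp
  qed
  have "m (m k) = k" using f(4)[of k] assms by auto
  moreover have "m k \<noteq> k" "k \<le> n" using f(3)[of k] mate_fun_mem_range[OF m refl, of k] assms by auto
  ultimately show ?thesis
    using *[of k "m k"] *[of "m k" k] assms by (cases "k < m k") auto
qed

section \<open>Relations for mate functions and scalars\<close>

lemma glue_capped:
  assumes m: "mate_fun n m" and i: "1 \<le> i" "i < n" "m i = i + 1" "m (i + 1) = i"
  shows "glue n i m = m"
proof
  fix k
  show "glue n i m k = m k"
    using i mate_fun_swap[OF m refl, of k] by (auto simp: glue_def)
qed

lemma glue_0_capped:
  assumes m: "mate_fun n m" and "m 1 = 0" "1 \<le> n"
  shows "glue n 0 m = m"
proof
  fix k
  show "glue n 0 m k = m k"
    using assms(2,3) mate_fun_swap[OF m refl, of k] mate_funD(1)[OF m, of k] by (auto simp: glue_def)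
qed

lemma glue_n_capped:
  assumes m: "mate_fun n m" and "m n = n + 1" "1 \<le> n"
  shows "glue n n m = m"
proof
  fix k
  show "glue n n m k = m k"
    using assms(2,3) mate_fun_swap[OF m refl, of k] mate_fun_mem_range[OF m refl, of k] by (auto simp: glue_def)
qed

lemma glue_caps:
  "1 \<le> i \<Longrightarrow> i < n \<Longrightarrow> glue n i m i = i + 1"
  "1 \<le> i \<Longrightarrow> i < n \<Longrightarrow> glue n i m (i + 1) = i"
  "glue n 0 m 1 = 0"
  "1 \<le> n \<Longrightarrow> glue n n m n = n + 1"
  by (auto simp: glue_def)

lemma glue_idem:
  assumes "mate_fun n m" "1 \<le> n" "i \<le> n"
  shows "glue n i (glue n i m) = glue n i m"
  using glue_capped[of n "glue n i m" i] glue_0_capped[of n "glue n i m"]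
    glue_n_capped[of n "glue n i m"] mate_fun_glue[OF assms] assms glue_caps
  by (cases "i = 0"; cases "i = n") auto

lemma coef_glue_same:
  assumes "1 \<le> n" "i \<le> n"
  shows "coef n \<delta>0 \<delta> \<delta>n \<beta>0 \<beta>1 i (glue n i m) = dlt n \<delta>0 \<delta> \<delta>n i"
  using assms glue_caps(1,2)[of i n m] glue_caps(3)[of n m] glue_caps(4)[of n m] by (auto simp: coef_def dlt_def)

text \<open>Applied to a matching already in the image of \<open>e\<^sub>i\<close>, this yields the
  matching part of \<open>e\<^sub>i e\<^sub>j e\<^sub>i = e\<^sub>i\<close>. For interior j, the
  mate c of the third point (i + 2 or i - 1) is passed by \<open>e\<^sub>j\<close> to the far end of
  the arc {i, i + 1}, and \<open>e\<^sub>i\<close> passes it back. For j = 0 or j = n both ends go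
  to the boundary and are then joined again.\<close>

lemma glue_glue_capped:
  assumes m: "mate_fun n m" and i: "1 \<le> i" "i < n" "m i = i + 1" "m (i + 1) = i"
    and j: "j = i + 1 \<or> j + 1 = i"
  shows "glue n i (glue n j m) = m"
proof
  fix k
  have sw: "m x = i \<longleftrightarrow> x = i + 1" "m x = i + 1 \<longleftrightarrow> x = i" for x
    using mate_fun_swap[OF m refl, of x] i by auto
  obtain e where e: "m k = e" by blast
  consider "j = i + 1" "j < n" | "j = i + 1" "j = n" | "j + 1 = i" "1 \<le> j" | "j = 0" "i = 1" using i j by linarith
  then show "glue n i (glue n j m) k = m k"
  proof cases
    case 1
    obtain c where c: "m (i + 2) = c" by blast
    have h: "glue n j m x = (if x = i + 1 then i + 2 else if x = i + 2 then i + 1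
        else if x = i then c else if m x = i + 2 then i else m x)" for x
      using 1 i c sw[of x] by (simp add: glue_def)
    have f: "glue n i f x = (if x = i then i + 1 else if x = i + 1 then i
        else if f x = i then f (i + 1) else if f x = i + 1 then f i else f x)" for x f
      using i by (simp add: glue_def)
    show ?thesis unfolding f unfolding h using 1 i sw[of k] e c by auto
  next
    case 2
    then show ?thesis using i sw[of k] by (auto simp: glue_def)
  next
    case 3
    obtain c where c: "m j = c" by blast
    have h: "glue n j m x = (if x = j then i else if x = i then j
        else if x = i + 1 then c else if m x = j then i + 1 else m x)" for x
      using 3 i c sw[of x] by (auto simp: glue_def)
    have f: "glue n i f x = (if x = i then i + 1 else if x = i + 1 then i
        else if f x = i then f (i + 1) else if f x = i + 1 then f i else f x)" for x f
      using i by (simp add: glue_def)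
    show ?thesis unfolding f unfolding h using 3 i sw[of k] e c by auto
  next
    case 4
    then show ?thesis using i sw[of k] by (auto simp: glue_def)
  qed
qed

text \<open>For interior j each step meets an arc with an interior mate and closes no loop. For j =
  0 the second factor is \<delta>0 to the power pty 0, for j = n it is \<delta>n to the power pty 2;
  the offsets i - 1 and n + 1 - i make both exponents vanish.\<close>

lemma coef_glue_glue_capped:
  assumes m: "mate_fun n m" and i: "1 \<le> i" "i < n" "m i = i + 1" "m (i + 1) = i"
    and j: "j = i + 1 \<or> j + 1 = i"
  shows "coef n \<delta>0 \<delta> \<delta>n \<beta>0 \<beta>1 j m = 1"
    and "coef n \<delta>0 \<delta> \<delta>n \<beta>0 \<beta>1 i (glue n j m) = 1"
proof -
  consider "j = i + 1" "j < n" | "j = i + 1" "j = n" | "j + 1 = i" "1 \<le> j" | "j = 0" "i = 1" using i j by linarith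
  moreover have "m (i + 2) \<noteq> i + 1" "1 \<le> j \<Longrightarrow> j + 1 = i \<Longrightarrow> m j \<noteq> i"
    using mate_fun_swap[OF m refl, of "i + 2"] mate_fun_swap[OF m refl, of j] i by auto
  ultimately have "coef n \<delta>0 \<delta> \<delta>n \<beta>0 \<beta>1 j m = 1 \<and> coef n \<delta>0 \<delta> \<delta>n \<beta>0 \<beta>1 i (glue n j m) = 1"
    using i by cases (auto simp: coef_def glue_def pty_def)
  then show "coef n \<delta>0 \<delta> \<delta>n \<beta>0 \<beta>1 j m = 1" "coef n \<delta>0 \<delta> \<delta>n \<beta>0 \<beta>1 i (glue n j m) = 1" by auto
qed

section \<open>Commutation of distant generators\<close>

lemma glue_comm_mid:
  assumes m: "mate_fun n m" and i: "1 \<le> i" and j: "i + 1 < j" "j < n"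
  shows "glue n i (glue n j m) = glue n j (glue n i m)"
proof
  fix k
  obtain a b c d e where v: "m i = a" "m (i + 1) = b" "m j = c" "m (j + 1) = d" "m k = e" by blast
  have *: "m x = y \<longleftrightarrow> m y = x" if "1 \<le> x" "x \<le> n" "1 \<le> y" "y \<le> n" for x y
    using mate_fun_swap[OF m, of x y] mate_fun_swap[OF m, of y x] that by auto
  have vv: "a = j \<longleftrightarrow> c = i" "a = j + 1 \<longleftrightarrow> d = i" "b = j \<longleftrightarrow> c = i + 1" "b = j + 1 \<longleftrightarrow> d = i + 1"
    using *[of i j] *[of i "j + 1"] *[of "i + 1" j] *[of "i + 1" "j + 1"] v i j by auto
  have k: "e = i \<Longrightarrow> k = a" "e = i + 1 \<Longrightarrow> k = b" "e = j \<Longrightarrow> k = c" "e = j + 1 \<Longrightarrow> k = d"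
    using mate_fun_swap[OF m v(5)] v i j by auto
  have g1: "glue n i m x = (if x = i then i + 1 else if x = i + 1 then i
      else if m x = i then b else if m x = i + 1 then a else m x)" for x
    using i j v by (simp add: glue_def)
  have g2: "glue n j m x = (if x = j then j + 1 else if x = j + 1 then j
      else if m x = j then d else if m x = j + 1 then c else m x)" for x
    using i j v by (simp add: glue_def)
  \<comment> \<open>An arbitrary f allows the outer gluing to be unfolded first; the inner one is
    then expressed by the named values a, b, c, d only.\<close>
  have f1: "glue n i f x = (if x = i then i + 1 else if x = i + 1 then i
      else if f x = i then f (i + 1) else if f x = i + 1 then f i else f x)" for x f
    using i j by (simp add: glue_def)
  have f2: "glue n j f x = (if x = j then j + 1 else if x = j + 1 then j
      else if f x = j then f (j + 1) else if f x = j + 1 then f j else f x)" for x f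
    using i j by (simp add: glue_def)
  show "glue n i (glue n j m) k = glue n j (glue n i m) k"
    unfolding f1[of "glue n j m"] f2[of "glue n i m"] unfolding g1 g2 v using vv k i j
    by auto
qed

lemma glue_comm_0_mid:
  assumes m: "mate_fun n m" and j: "1 < j" "j < n"
  shows "glue n 0 (glue n j m) = glue n j (glue n 0 m)"
proof
  fix k
  obtain b c d e where v: "m 1 = b" "m j = c" "m (j + 1) = d" "m k = e" by blast
  have *: "m x = y \<longleftrightarrow> m y = x" if "1 \<le> x" "x \<le> n" "1 \<le> y" "y \<le> n" for x y
    using mate_fun_swap[OF m, of x y] mate_fun_swap[OF m, of y x] that by auto
  have vv: "b = j \<longleftrightarrow> c = 1" "b = j + 1 \<longleftrightarrow> d = 1"
    using *[of 1 j] *[of 1 "j + 1"] v j by auto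
  have k: "e = 1 \<Longrightarrow> k = b" "e = j \<Longrightarrow> k = c" "e = j + 1 \<Longrightarrow> k = d"
    using mate_fun_swap[OF m v(4)] v j by auto
  have g1: "glue n 0 f x = (if x = 1 \<or> f x = 1 then 0 else f x)" for f x
    by (simp add: glue_def)
  have g2: "glue n j m x = (if x = j then j + 1 else if x = j + 1 then j
      else if m x = j then d else if m x = j + 1 then c else m x)" for x
    using j v by (simp add: glue_def)
  have f2: "glue n j f x = (if x = j then j + 1 else if x = j + 1 then j
      else if f x = j then f (j + 1) else if f x = j + 1 then f j else f x)" for x f
    using j by (simp add: glue_def)
  show "glue n 0 (glue n j m) k = glue n j (glue n 0 m) k"
    unfolding f2[of "glue n 0 m"] unfolding g1 g2 v using vv k j by auto
qed

lemma glue_comm_mid_n: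
  assumes m: "mate_fun n m" and i: "1 \<le> i" "i + 1 < n"
  shows "glue n i (glue n n m) = glue n n (glue n i m)"
proof
  fix k
  obtain a b c e where v: "m i = a" "m (i + 1) = b" "m n = c" "m k = e" by blast
  have *: "m x = y \<longleftrightarrow> m y = x" if "1 \<le> x" "x \<le> n" "1 \<le> y" "y \<le> n" for x y
    using mate_fun_swap[OF m, of x y] mate_fun_swap[OF m, of y x] that by auto
  have vv: "a = n \<longleftrightarrow> c = i" "b = n \<longleftrightarrow> c = i + 1"
    using *[of i n] *[of "i + 1" n] v i by auto
  have k: "e = i \<Longrightarrow> k = a" "e = i + 1 \<Longrightarrow> k = b" "e = n \<Longrightarrow> k = c"
    using mate_fun_swap[OF m v(4)] v i by auto
  have g1: "glue n n f x = (if x = n \<or> f x = n then n + 1 else f x)" for f x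
    using i by (simp add: glue_def)
  have g2: "glue n i m x = (if x = i then i + 1 else if x = i + 1 then i
      else if m x = i then b else if m x = i + 1 then a else m x)" for x
    using i v by (simp add: glue_def)
  have f2: "glue n i f x = (if x = i then i + 1 else if x = i + 1 then i
      else if f x = i then f (i + 1) else if f x = i + 1 then f i else f x)" for x f
    using i by (simp add: glue_def)
  show "glue n i (glue n n m) k = glue n n (glue n i m) k"
    unfolding f2[of "glue n n m"] unfolding g1 g2 v using vv k i by auto
qed

lemma glue_comm_0_n:
  assumes "2 \<le> n"
  shows "glue n 0 (glue n n m) = glue n n (glue n 0 m)"
proof
  fix k
  show "glue n 0 (glue n n m) k = glue n n (glue n 0 m) k"
    using assms by (auto simp: glue_def)
qed

text \<open>The weight of a generator depends only on the mates of its own two points, so without an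
  arc between the two pairs nothing changes. Otherwise the shapes of such arcs are enumerated; a
  boundary weight can survive only when the single arc joins i + 1 and j.\<close>

lemma coef_comm_mid:
  assumes m: "mate_fun n m" and i: "1 \<le> i" and j: "i + 1 < j" "j < n"
  shows "coef n \<delta>0 \<delta> \<delta>n \<beta>0 \<beta>1 i m * coef n \<delta>0 \<delta> \<delta>n \<beta>0 \<beta>1 j (glue n i m)
       = coef n \<delta>0 \<delta> \<delta>n \<beta>0 \<beta>1 j m * coef n \<delta>0 \<delta> \<delta>n \<beta>0 \<beta>1 i (glue n j m)"
proof -
  obtain a b c d where v: "m i = a" "m (i + 1) = b" "m j = c" "m (j + 1) = d" by blast
  have *: "m x = y \<longleftrightarrow> m y = x" if "1 \<le> x" "x \<le> n" "1 \<le> y" "y \<le> n" for x y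
    using mate_fun_swap[OF m, of x y] mate_fun_swap[OF m, of y x] that by auto
  have vv: "a = j \<longleftrightarrow> c = i" "a = j + 1 \<longleftrightarrow> d = i" "b = j \<longleftrightarrow> c = i + 1" "b = j + 1 \<longleftrightarrow> d = i + 1"
    using *[of i j] *[of i "j + 1"] *[of "i + 1" j] *[of "i + 1" "j + 1"] v i j by auto
  have ai: "a = i + 1 \<longleftrightarrow> b = i" "c = j + 1 \<longleftrightarrow> d = j"
    using *[of i "i + 1"] *[of j "j + 1"] v i j by auto
  have nca: "b \<le> a \<and> i < b" if "i + 1 < a" using mate_funD(5)[OF m, of i "i + 1"] i v that by auto
  have ncb: "c \<le> b \<and> i + 1 < c" if "b = j + 1" using mate_funD(5)[OF m, of "i + 1" j] i j v that by auto
  have g: "glue n i m j = (if c = i then b else if c = i + 1 then a else c)"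
    "glue n i m (j + 1) = (if d = i then b else if d = i + 1 then a else d)"
    "glue n j m i = (if a = j then d else if a = j + 1 then c else a)"
    "glue n j m (i + 1) = (if b = j then d else if b = j + 1 then c else b)"
    using i j v by (auto simp: glue_def)
  \<comment> \<open>The weight at position k as a function of the two mates, so that the weights at
    i and j can be compared on the same arguments.\<close>
  define W where "W k x y = (if x = k + 1 then \<delta>
      else if x = 0 \<and> y = 0 then \<delta>0 ^ pty (k - 1)
      else if x = n + 1 \<and> y = n + 1 then \<delta>n ^ pty (n + 1 - k)
      else if x = 0 \<and> y = n + 1 then beta \<beta>0 \<beta>1 (pty k) else 1)" for k x y
  have Ci: "coef n \<delta>0 \<delta> \<delta>n \<beta>0 \<beta>1 i f = W i (f i) (f (i + 1))" for f
    using i j by (simp add: coef_def W_def)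
  have Cj: "coef n \<delta>0 \<delta> \<delta>n \<beta>0 \<beta>1 j f = W j (f j) (f (j + 1))" for f
    using i j by (simp add: coef_def W_def)
  have W1: "W k x y = 1" if "x \<noteq> k + 1" "(x \<noteq> 0 \<and> x \<noteq> n + 1) \<or> (y \<noteq> 0 \<and> y \<noteq> n + 1)" for k x y
    using that by (auto simp: W_def)
  have n1: "a \<noteq> i" "b \<noteq> i + 1" "c \<noteq> j" "d \<noteq> j + 1"
    using mate_funD(3)[OF m, of i] mate_funD(3)[OF m, of "i + 1"] mate_funD(3)[OF m, of j]
      mate_funD(3)[OF m, of "j + 1"] v i j by auto
  consider "a \<noteq> j" "a \<noteq> j + 1" "b \<noteq> j" "b \<noteq> j + 1" | "a = j + 1" "b = j" | "a = j" "b \<noteq> j + 1" |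
    "a = j" "b = j + 1" | "b = j" "a \<noteq> j + 1" | "b = j + 1" | "a = j + 1" "b \<noteq> j" by blast
  then show ?thesis
  proof cases
    case 1
    then have "c \<noteq> i" "d \<noteq> i" "c \<noteq> i + 1" "d \<noteq> i + 1" using vv by auto
    with 1 show ?thesis unfolding Ci Cj g unfolding v by (simp add: mult.commute)
  next
    \<comment> \<open>Two nested arcs join the pairs: whichever generator acts first contributes 1,
      and the second closes a loop of weight \<delta>.\<close>
    case 2
    then have "d = i" "c = i + 1" using vv by auto
    with 2 j i show ?thesis unfolding Ci Cj g unfolding v by (simp add: W1) (simp add: W_def)
  next
    \<comment> \<open>The arc {i, j} encloses i + 1, whose mate b is therefore interior; all four
      weights are 1.\<close>
    case 3
    then have "c = i" "i < b" "b < j" "d \<noteq> i" "d \<noteq> i + 1" using vv nca i j *[of i j] *[of "i + 1" j] v by auto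
    with 3 j i n1 show ?thesis unfolding Ci Cj g unfolding v by (simp add: W1)
  next
    case 4
    then show ?thesis using nca j by auto
  next
    \<comment> \<open>The arc {i + 1, j} passes the mate a of i to j in one order and the mate d of
      j + 1 to i + 1 in the other. The second generator thus sees the mates a and d in either order,
      and equal parity of i and j equates the weights.\<close>
    case 5
    then have c: "c = i + 1" "d \<noteq> i" "d \<noteq> i + 1" "a \<noteq> j" using vv i by auto
    have p: "even i \<longleftrightarrow> even j" using mate_parity[OF m, of "i + 1"] v 5 j by auto
    have "even (i - 1) \<longleftrightarrow> even (j - 1)" "even (n + 1 - i) \<longleftrightarrow> even (n + 1 - j)"
      using p i j by auto
    then have p': "pty (i - 1) = pty (j - 1)" "pty (n + 1 - i) = pty (n + 1 - j)" "pty i = pty j"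
      unfolding pty_def using p by auto
    have "a \<noteq> i + 1" using 5 ai j by auto
    then have "W i a d = W j a d" using 5 unfolding W_def p' by simp
    with 5 c j i n1 \<open>a \<noteq> i + 1\<close> show ?thesis unfolding Ci Cj g unfolding v by (simp add: W1)
  next
    \<comment> \<open>The arc {i + 1, j + 1} encloses j, so c is interior and all four weights are
      1.\<close>
    case 6
    then have c: "c \<le> n" "i + 1 < c" "c \<noteq> i" "d = i + 1" "a \<noteq> j" "a \<noteq> j + 1" "a \<noteq> i + 1" "c \<noteq> j + 1"
      using ncb vv ai j i by auto
    with 6 j i n1 show ?thesis unfolding Ci Cj g unfolding v by (simp add: W1)
  next
    \<comment> \<open>The arc {i, j + 1} encloses i + 1 and j, so b and c are interior and all four
      weights are 1.\<close>
    case 7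
    then have c: "d = i" "b \<le> n" "i < b" "c \<noteq> i" "c \<noteq> i + 1" "b \<noteq> j + 1" "c \<noteq> j + 1"
      using nca vv ai j i by auto
    moreover have "c \<noteq> 0" "c \<noteq> n + 1" "c \<noteq> i + 1" using mate_funD(5)[OF m, of i j] i j v 7 c by auto
    ultimately show ?thesis using 7 j i n1 unfolding Ci Cj g unfolding v by (simp add: W1)
  qed
qed

text \<open>An arc {1, j} forces j even, so the weights at j become \<delta>0 and \<beta>0, exactly
  those of \<open>e\<^sub>0\<close>. An arc {1, j + 1} encloses j, whose mate is then interior, and
  no weight appears.\<close>

lemma coef_comm_0_mid:
  assumes m: "mate_fun n m" and j: "1 < j" "j < n"
  shows "coef n \<delta>0 \<delta> \<delta>n \<beta>0 \<beta>1 0 m * coef n \<delta>0 \<delta> \<delta>n \<beta>0 \<beta>1 j (glue n 0 m)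
       = coef n \<delta>0 \<delta> \<delta>n \<beta>0 \<beta>1 j m * coef n \<delta>0 \<delta> \<delta>n \<beta>0 \<beta>1 0 (glue n j m)"
proof -
  obtain b c d where v: "m 1 = b" "m j = c" "m (j + 1) = d" by blast
  have *: "m x = y \<longleftrightarrow> m y = x" if "1 \<le> x" "x \<le> n" "1 \<le> y" "y \<le> n" for x y
    using mate_fun_swap[OF m, of x y] mate_fun_swap[OF m, of y x] that by auto
  have vv: "b = j \<longleftrightarrow> c = 1" "b = j + 1 \<longleftrightarrow> d = 1" 
    using *[of 1 j] *[of 1 "j + 1"] v j by auto
  have cd: "c = j + 1 \<longleftrightarrow> d = j"
    using *[of j "j + 1"] v j by auto
  have g: "glue n 0 m j = (if c = 1 then 0 else c)"
    "glue n 0 m (j + 1) = (if d = 1 then 0 else d)"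
    "glue n j m 1 = (if b = j then d else if b = j + 1 then c else b)"
    using j v by (auto simp: glue_def)
  have C0: "coef n \<delta>0 \<delta> \<delta>n \<beta>0 \<beta>1 0 f = (if f 1 = 0 then \<delta>0 else if f 1 = n + 1 then \<beta>0 else 1)" for f
    by (simp add: coef_def)
  have Cj: "\<And>f. coef n \<delta>0 \<delta> \<delta>n \<beta>0 \<beta>1 j f = (if f j = j + 1 then \<delta>
      else if f j = 0 \<and> f (j + 1) = 0 then \<delta>0 ^ pty (j - 1)
      else if f j = n + 1 \<and> f (j + 1) = n + 1 then \<delta>n ^ pty (n + 1 - j)
      else if f j = 0 \<and> f (j + 1) = n + 1 then beta \<beta>0 \<beta>1 (pty j)
      else 1)" using j by (simp add: coef_def)
  consider "b \<noteq> j" "b \<noteq> j + 1" | "b = j" | "b = j + 1" by blast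
  then show ?thesis
  proof cases
    case 1
    then show ?thesis using vv unfolding C0 Cj g unfolding v by simp
  next
    case 2
    then have c: "c = 1" "d \<noteq> 1" "d \<noteq> j" using vv cd j by auto
    have "even j" using mate_parity[OF m, of 1] v 2 j by auto
    then have "pty j = 0" "pty (j - 1) = 1" using j by (auto simp: pty_def)
    then show ?thesis using 2 c j unfolding C0 Cj g unfolding v by (auto simp: beta_def)
  next
    case 3
    then have c: "d = 1" "c \<noteq> 1" "c \<noteq> j + 1" using vv cd j by auto
    have "c \<noteq> 0" "c \<noteq> n + 1" using mate_funD(5)[OF m, of 1 j] j v 3 by auto
    then show ?thesis using 3 c j unfolding C0 Cj g unfolding v by auto
  qed
qed

text \<open>An arc {i + 1, n} gives i and n equal parity, so the exponent of \<delta>n at i is 1 and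
  both generators use the same \<beta>. An arc {i, n} encloses i + 1, whose mate is then
  interior.\<close>

lemma coef_comm_mid_n:
  assumes m: "mate_fun n m" and i: "1 \<le> i" "i + 1 < n"
  shows "coef n \<delta>0 \<delta> \<delta>n \<beta>0 \<beta>1 i m * coef n \<delta>0 \<delta> \<delta>n \<beta>0 \<beta>1 n (glue n i m)
       = coef n \<delta>0 \<delta> \<delta>n \<beta>0 \<beta>1 n m * coef n \<delta>0 \<delta> \<delta>n \<beta>0 \<beta>1 i (glue n n m)"
proof -
  obtain a b c where v: "m i = a" "m (i + 1) = b" "m n = c" by blast
  have *: "m x = y \<longleftrightarrow> m y = x" if "1 \<le> x" "x \<le> n" "1 \<le> y" "y \<le> n" for x y
    using mate_fun_swap[OF m, of x y] mate_fun_swap[OF m, of y x] that by auto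
  have vv: "a = n \<longleftrightarrow> c = i" "b = n \<longleftrightarrow> c = i + 1" 
    using *[of i n] *[of "i + 1" n] v i by auto
  have ab: "a = i + 1 \<longleftrightarrow> b = i"
    using *[of i "i + 1"] v i by auto
  have g: "glue n n m i = (if a = n then n + 1 else a)"
    "glue n n m (i + 1) = (if b = n then n + 1 else b)"
    "glue n i m n = (if c = i then b else if c = i + 1 then a else c)"
    using i v by (auto simp: glue_def)
  have Cn: "coef n \<delta>0 \<delta> \<delta>n \<beta>0 \<beta>1 n f
      = (if f n = n + 1 then \<delta>n else if f n = 0 then beta \<beta>0 \<beta>1 (pty n) else 1)" for f
    using i by (simp add: coef_def)
  have Ci: "\<And>f. coef n \<delta>0 \<delta> \<delta>n \<beta>0 \<beta>1 i f = (if f i = i + 1 then \<delta>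
      else if f i = 0 \<and> f (i + 1) = 0 then \<delta>0 ^ pty (i - 1)
      else if f i = n + 1 \<and> f (i + 1) = n + 1 then \<delta>n ^ pty (n + 1 - i)
      else if f i = 0 \<and> f (i + 1) = n + 1 then beta \<beta>0 \<beta>1 (pty i)
      else 1)" using i by (simp add: coef_def)
  consider "a \<noteq> n" "b \<noteq> n" | "a = n" | "b = n" "a \<noteq> n" by blast
  then show ?thesis
  proof cases
    case 1
    then show ?thesis using vv unfolding Ci Cn g unfolding v by simp
  next
    case 2
    then have c: "c = i" "b \<noteq> n" "b \<noteq> n + 1" "b \<noteq> 0" "b \<noteq> i"
      using vv ab i mate_funD(5)[OF m, of i "i + 1"] v by auto
    then show ?thesis using 2 i unfolding Ci Cn g unfolding v by auto
  next
    case 3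
    then have c: "c = i + 1" "a \<noteq> i + 1" using vv ab i by auto
    have "even i \<longleftrightarrow> even n" using mate_parity[OF m, of "i + 1"] v 3 i by auto
    then have "pty i = pty n" "pty (n + 1 - i) = 1" using i by (auto simp: pty_def)
    then show ?thesis using 3 c i unfolding Ci Cn g unfolding v by auto
  qed
qed

text \<open>Only the arc {1, n} lets the two generators interact. It forces n even, so the weight of
  \<open>e\<^sub>n\<close> on an arc from 0 to n is \<beta>0, the weight of \<open>e\<^sub>0\<close>
  on an arc from 1 to n + 1.\<close>

lemma coef_comm_0_n:
  assumes m: "mate_fun n m" and n: "2 \<le> n"
  shows "coef n \<delta>0 \<delta> \<delta>n \<beta>0 \<beta>1 0 m * coef n \<delta>0 \<delta> \<delta>n \<beta>0 \<beta>1 n (glue n 0 m)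
       = coef n \<delta>0 \<delta> \<delta>n \<beta>0 \<beta>1 n m * coef n \<delta>0 \<delta> \<delta>n \<beta>0 \<beta>1 0 (glue n n m)"
proof (cases "m 1 = n")
  case True
  then have "m n = 1" using mate_fun_swap[OF m, of 1 n] n by simp
  moreover have "even n" using mate_parity[OF m, of 1] True n by auto
  ultimately show ?thesis using True n by (auto simp: coef_def glue_def beta_def pty_def)
next
  case False
  then have "m n \<noteq> 1" using mate_fun_swap[OF m, of n 1] n by auto
  then show ?thesis using False n by (auto simp: coef_def glue_def)
qed

lemma glue_comm:
  assumes m: "mate_fun n m" and j: "i + 1 < j" "j \<le> n"
  shows "glue n i (glue n j m) = glue n j (glue n i m)"
  using glue_comm_mid[OF m, of i j] glue_comm_0_mid[OF m, of j] glue_comm_mid_n[OF m, of i]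
    glue_comm_0_n[of n m] j by (cases "i = 0"; cases "j = n") auto

lemma coef_comm:
  assumes m: "mate_fun n m" and j: "i + 1 < j" "j \<le> n"
  shows "coef n \<delta>0 \<delta> \<delta>n \<beta>0 \<beta>1 i m * coef n \<delta>0 \<delta> \<delta>n \<beta>0 \<beta>1 j (glue n i m)
       = coef n \<delta>0 \<delta> \<delta>n \<beta>0 \<beta>1 j m * coef n \<delta>0 \<delta> \<delta>n \<beta>0 \<beta>1 i (glue n j m)"
  using coef_comm_mid[OF m, of i j] coef_comm_0_mid[OF m, of j] coef_comm_mid_n[OF m, of i]
    coef_comm_0_n[OF m] j by (cases "i = 0"; cases "j = n") auto

section \<open>Matchings and mate functions\<close>

text \<open>At a boundary point lying in no pair or in several pairs the definite description in
  \<open>mate\<close> is unspecified; the cut-off replaces it by the default value that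
  \<open>mate_fun\<close> demands.\<close>

definition mates :: "nat \<Rightarrow> nat set set \<Rightarrow> nat \<Rightarrow> nat" where
  "mates n p k = (if 1 \<le> k \<and> k \<le> n then mate p k else 0)"

definition pairs :: "nat \<Rightarrow> (nat \<Rightarrow> nat) \<Rightarrow> nat set set" where
  "pairs n m = {{k, m k} | k. 1 \<le> k \<and> k \<le> n}"

lemma S_pairsE:
  assumes "q \<in> S_pairs n"
  obtains x y where "q = {x, y}" "x < y" "y \<le> n + 1"
proof -
  obtain x y where "q = {x, y}" "x \<noteq> y" "x \<le> n + 1" "y \<le> n + 1"
    using assms unfolding S_pairs_def by blast
  then show ?thesis using that[of x y] that[of y x] by (cases "x < y") (auto simp: insert_commute)
qed

lemma mate_eq_iff:
  assumes p: "p \<in> matchings n" and k: "1 \<le> k" "k \<le> n"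
  shows "{k, j} \<in> p \<longleftrightarrow> mate p k = j"
proof -
  have sub: "p \<subseteq> S_pairs n" and ex: "\<exists>!q. q \<in> p \<and> k \<in> q"
    using p k unfolding matchings_def by auto
  obtain q where q: "q \<in> p" "k \<in> q" and uq: "\<And>q'. q' \<in> p \<Longrightarrow> k \<in> q' \<Longrightarrow> q' = q"
    using ex by auto
  obtain x y where xy: "q = {x, y}" "x < y" using S_pairsE sub q(1) by (metis subsetD)
  obtain l where l: "q = {k, l}" using xy q(2) by auto
  have u: "{k, j'} \<in> p \<longleftrightarrow> j' = l" for j'
    using uq[of "{k, j'}"] l q(1) by (auto simp: doubleton_eq_iff)
  then have "mate p k = l" unfolding mate_def by simp
  with u show ?thesis by auto
qed

lemma mate_bounds:
  assumes p: "p \<in> matchings n" and k: "1 \<le> k" "k \<le> n"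
  shows "mate p k \<le> n + 1" "mate p k \<noteq> k"
proof -
  have "{k, mate p k} \<in> S_pairs n"
    using mate_eq_iff[OF p k] p unfolding matchings_def by auto
  then show "mate p k \<le> n + 1" "mate p k \<noteq> k"
    by (auto elim!: S_pairsE simp: doubleton_eq_iff)
qed

lemma mate_mate:
  assumes p: "p \<in> matchings n" and k: "1 \<le> k" "k \<le> n" and j: "1 \<le> mate p k" "mate p k \<le> n"
  shows "mate p (mate p k) = k"
  using mate_eq_iff[OF p k, of "mate p k"] mate_eq_iff[OF p j, of k] by (simp add: insert_commute)

lemma mate_fun_mates:
  assumes p: "p \<in> matchings n"
  shows "mate_fun n (mates n p)"
  unfolding mate_fun_def
proof (intro conjI allI impI)
  fix k assume "k < 1 \<or> n < k" then show "mates n p k = 0" by (auto simp: mates_def)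
next
  fix k assume "1 \<le> k \<and> k \<le> n"
  then show "mates n p k \<le> n + 1" "mates n p k \<noteq> k" 
    using mate_bounds[OF p, of k] by (auto simp: mates_def)
next
  fix k assume "1 \<le> k \<and> k \<le> n \<and> 1 \<le> mates n p k \<and> mates n p k \<le> n"
  then show "mates n p (mates n p k) = k"
    using mate_mate[OF p, of k] by (auto simp: mates_def)
next
  fix k l assume kl: "1 \<le> k \<and> k < l \<and> l < mates n p k"
  then have k: "1 \<le> k" "k \<le> n" "k < l" by (auto simp: mates_def split: if_splits)
  then have l: "1 \<le> l" "l \<le> n" "l < mate p k"
    using kl mate_bounds[OF p, of k] by (auto simp: mates_def)
  have in_p: "{k, mate p k} \<in> p" "{l, mate p l} \<in> p" "{mate p l, l} \<in> p"
    using mate_eq_iff[OF p k(1,2), of "mate p k"] mate_eq_iff[OF p l(1,2), of "mate p l"]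
    by (auto simp: insert_commute[of _ l])
  have "\<nexists>i j k l. {i, j} \<in> p \<and> {k, l} \<in> p \<and> i < k \<and> k < j \<and> j < l"
    using p unfolding matchings_def by (elim CollectE conjE)
  then have nc: "\<not> (i < k' \<and> k' < j \<and> j < l')" if "{i, j} \<in> p" "{k', l'} \<in> p" for i j k' l'
    using that by metis
  \<comment> \<open>The upper bound on the mate of l can only be weak: k and l may both be paired
    with n + 1.\<close>
  have "mate p l \<noteq> k" using mate_mate[OF p, of l] k l by auto
  moreover have "\<not> mate p l < k" using nc[OF in_p(3,1)] k l by auto
  moreover have "\<not> mate p k < mate p l" using nc[OF in_p(1,2)] k l by auto
  ultimately show "k < mates n p l" "mates n p l \<le> mates n p k" using k l by (auto simp: mates_def)
qed

lemma pairs_mates: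
  assumes p: "p \<in> matchings n"
  shows "pairs n (mates n p) = p"
proof
  show "pairs n (mates n p) \<subseteq> p"
    using mate_eq_iff[OF p] by (auto simp: pairs_def mates_def)
next
  show "p \<subseteq> pairs n (mates n p)"
  proof
    fix q assume q: "q \<in> p"
    then obtain x y where xy: "q = {x, y}" "x < y" "y \<le> n + 1"
      using p S_pairsE[of q n] unfolding matchings_def by auto
    \<comment> \<open>Excluding {0, n + 1} is what gives every pair an interior point, so that mates
      at interior points recover the whole matching.\<close>
    have "q \<noteq> {0, n + 1}" using p q unfolding matchings_def by auto
    then have "1 \<le> x \<and> x \<le> n \<or> 1 \<le> y \<and> y \<le> n" using xy by (cases "x = 0") auto
    then obtain k j where k: "1 \<le> k" "k \<le> n" "q = {k, j}" using xy by (metis insert_commute)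
    then have "mates n p k = j" using mate_eq_iff[OF p k(1,2), of j] q by (simp add: mates_def)
    then show "q \<in> pairs n (mates n p)" using k unfolding pairs_def by auto
  qed
qed

lemma in_pairs_iff:
  assumes m: "mate_fun n m" and i: "1 \<le> i" "i \<le> n"
  shows "{i, j} \<in> pairs n m \<longleftrightarrow> m i = j"
proof
  assume "{i, j} \<in> pairs n m"
  then obtain k where "1 \<le> k" "k \<le> n" "{i, j} = {k, m k}" unfolding pairs_def by auto
  then show "m i = j" using mate_fun_swap[OF m, of k i] i by (auto simp: doubleton_eq_iff)
qed (use i in \<open>auto simp: pairs_def\<close>)

lemma pairs_in_matchings:
  assumes m: "mate_fun n m"
  shows "pairs n m \<in> matchings n"
  unfolding matchings_def
proof (intro CollectI conjI allI impI)
  show "pairs n m \<subseteq> S_pairs n"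
  proof
    fix q assume "q \<in> pairs n m"
    then obtain k where "1 \<le> k" "k \<le> n" "q = {k, m k}" unfolding pairs_def by auto
    moreover have "m k \<noteq> k" "m k \<le> n + 1" using mate_funD(2,3)[OF m, of k] \<open>1 \<le> k\<close> by auto
    ultimately show "q \<in> S_pairs n" unfolding S_pairs_def by force
  qed
next
  fix i assume i: "1 \<le> i \<and> i \<le> n"
  show "\<exists>!q. q \<in> pairs n m \<and> i \<in> q"
  proof (rule ex1I[of _ "{i, m i}"])
    show "{i, m i} \<in> pairs n m \<and> i \<in> {i, m i}" using i by (auto simp: pairs_def)
  next
    fix q assume "q \<in> pairs n m \<and> i \<in> q"
    then obtain k where "1 \<le> k" "k \<le> n" "q = {k, m k}" "i \<in> {k, m k}" unfolding pairs_def by auto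
    then show "q = {i, m i}" using mate_fun_swap[OF m, of k i] i by auto
  qed
next
  show "\<nexists>i j k l. {i, j} \<in> pairs n m \<and> {k, l} \<in> pairs n m \<and> i < k \<and> k < j \<and> j < l"
  proof (intro notI, elim exE conjE)
    fix i j k l
    assume ij: "{i, j} \<in> pairs n m" and kl: "{k, l} \<in> pairs n m" and o: "i < k" "k < j" "j < l"
    \<comment> \<open>In a crossing i < k < j < l the two middle points are interior even if i = 0
      or l = n + 1. Their mates l and i then contradict the non-crossing clause at k < j.\<close>
    have "l \<le> n + 1" using kl mate_funD(2)[OF m] unfolding pairs_def by (auto simp: doubleton_eq_iff)
    then have j: "1 \<le> j" "j \<le> n" and k: "1 \<le> k" "k \<le> n" using o by auto
    then have "m j = i" "m k = l"
      using in_pairs_iff[OF m, of j i] in_pairs_iff[OF m, of k l] ij kl by (auto simp: insert_commute)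
    then show False using mate_funD(5)[OF m, of k j] k o by auto
  qed
next
  show "{0, n + 1} \<notin> pairs n m" by (auto simp: pairs_def doubleton_eq_iff)
qed

lemma mates_pairs:
  assumes m: "mate_fun n m"
  shows "mates n (pairs n m) = m"
proof
  fix k
  show "mates n (pairs n m) k = m k"
    using mate_eq_iff[OF pairs_in_matchings[OF m], of k "m k"] in_pairs_iff[OF m, of k "m k"]
      mate_funD(1)[OF m, of k]
    by (cases "1 \<le> k \<and> k \<le> n") (auto simp: mates_def)
qed

section \<open>The prescribed action expressed by gluing\<close>

text \<open>If both mates are boundary points, joining them would produce {0}, {n + 1} or {0, n +
  1}, none of them admissible. This is why the prescription drops the joined pair in exactly these
  cases and records a scalar instead.\<close>

lemma pairs_glue_mid:
  assumes m: "mate_fun n m" and i: "1 \<le> i" "i < n" "m i \<noteq> i + 1"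
  shows "pairs n (glue n i m) = rem_i (pairs n m) i \<union> {{i, i + 1}} \<union>
    (if 1 \<le> m i \<and> m i \<le> n \<or> 1 \<le> m (i + 1) \<and> m (i + 1) \<le> n then {{m i, m (i + 1)}} else {})"
    (is "?L = ?R")
proof -
  obtain a b where a: "m i = a" and b: "m (i + 1) = b" by blast
  have g: "glue n i m k = (if k = i then i + 1 else if k = i + 1 then i
      else if m k = i then b else if m k = i + 1 then a else m k)" for k
    using i a b by (simp add: glue_def)
  have sw: "m k = i \<Longrightarrow> k = a \<and> 1 \<le> a \<and> a \<le> n" "m k = i + 1 \<Longrightarrow> k = b \<and> 1 \<le> b \<and> b \<le> n" for k
    using mate_fun_swap[OF m, of k i] mate_fun_swap[OF m, of k "i + 1"] i a b
      mate_fun_mem_range[OF m, of k i] mate_fun_mem_range[OF m, of k "i + 1"] by auto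
  have iv: "1 \<le> a \<Longrightarrow> a \<le> n \<Longrightarrow> m a = i" "1 \<le> b \<Longrightarrow> b \<le> n \<Longrightarrow> m b = i + 1"
    using mate_funD(4)[OF m, of i] mate_funD(4)[OF m, of "i + 1"] a b by auto
  have ab: "a \<noteq> i" "b \<noteq> i + 1" "a \<noteq> i + 1" "b \<noteq> i"
    using mate_funD(3)[OF m, of i] mate_funD(3)[OF m, of "i + 1"] sw(1)[of "i + 1"] a b i by auto
  have "?L \<subseteq> ?R"
  proof
    fix q assume "q \<in> ?L"
    then obtain k where k: "1 \<le> k" "k \<le> n" "q = {k, glue n i m k}" unfolding pairs_def by auto
    consider "k = i \<or> k = i + 1" | "k \<noteq> i" "k \<noteq> i + 1" "m k = i" | "k \<noteq> i" "k \<noteq> i + 1" "m k = i + 1"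
      | "k \<noteq> i" "k \<noteq> i + 1" "m k \<noteq> i" "m k \<noteq> i + 1" by blast
    then show "q \<in> ?R"
    proof cases
      case 1 then show ?thesis using k by (auto simp: g insert_commute)
    next
      case 2
      then have "q = {a, b}" using k sw(1)[of k] by (simp add: g)
      then show ?thesis using sw(1)[OF 2(3)] a b by simp
    next
      case 3
      then have "q = {a, b}" using k sw(2)[of k] by (simp add: g insert_commute)
      then show ?thesis using sw(2)[OF 3(3)] a b by simp
    next
      case 4
      then have "q = {k, m k}" using k by (simp add: g)
      then have "q \<in> rem_i (pairs n m) i" using k 4 unfolding rem_i_def pairs_def by auto
      then show ?thesis by simp
    qed
  qed
  moreover have "?R \<subseteq> ?L"
  proof
    fix q assume "q \<in> ?R"
    then consider "q \<in> rem_i (pairs n m) i" | "q = {i, i + 1}" | "1 \<le> a" "a \<le> n" "q = {a, b}"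
      | "1 \<le> b" "b \<le> n" "q = {a, b}" using a b by (auto split: if_splits)
    then have "\<exists>k. q = {k, glue n i m k} \<and> 1 \<le> k \<and> k \<le> n"
    proof cases
      case 1
      then obtain k where "1 \<le> k" "k \<le> n" "q = {k, m k}" "i \<notin> q" "i + 1 \<notin> q"
        unfolding rem_i_def pairs_def by auto
      then show ?thesis by (intro exI[of _ k]) (auto simp: g)
    next
      case 2 then show ?thesis using i by (intro exI[of _ i]) (auto simp: g)
    next
      case 3 then show ?thesis using iv ab by (intro exI[of _ a]) (auto simp: g)
    next
      case 4 then show ?thesis using iv ab by (intro exI[of _ b]) (auto simp: g)
    qed
    then show "q \<in> ?L" unfolding pairs_def by simp
  qed
  ultimately show ?thesis by (rule equalityI)
qed

text \<open>The joined pair is missing precisely when it would be {0, n + 1}, which is the case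
  weighted by \<beta>0.\<close>

lemma pairs_glue_0:
  assumes m: "mate_fun n m" and n: "1 \<le> n" "m 1 \<noteq> 0"
  shows "pairs n (glue n 0 m) = rem_0 (pairs n m) \<union> {{0, 1}} \<union>
    (if m 1 \<noteq> n + 1 then {{0, m 1}} else {})"
    (is "?L = ?R")
proof -
  obtain b where b: "m 1 = b" by blast
  have g: "glue n 0 m k = (if k = 1 \<or> m k = 1 then 0 else m k)" for k
    by (simp add: glue_def)
  have sw: "m k = 1 \<Longrightarrow> k = b \<and> b \<le> n" for k
    using mate_fun_swap[OF m, of k 1] mate_fun_mem_range[OF m, of k 1] n b by auto
  have b1: "b \<le> n + 1" "b \<noteq> 1" using mate_funD(2,3)[OF m, of 1] b by auto
  have iv: "b \<le> n \<Longrightarrow> m b = 1"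
    using mate_funD(4)[OF m, of 1] b n by auto
  have "?L \<subseteq> ?R"
  proof
    fix q assume "q \<in> ?L"
    then obtain k where k: "1 \<le> k" "k \<le> n" "q = {k, glue n 0 m k}" unfolding pairs_def by auto
    consider "k = 1" | "k \<noteq> 1" "m k = 1" | "k \<noteq> 1" "m k \<noteq> 1" by blast
    then show "q \<in> ?R"
    proof cases
      case 1 then show ?thesis using k by (auto simp: g insert_commute)
    next
      case 2
      then have "q = {0, b}" "b \<le> n" using k sw[of k] by (auto simp: g insert_commute)
      then show ?thesis using b by simp
    next
      case 3
      then have "q = {k, m k}" using k by (simp add: g)
      then have "q \<in> rem_0 (pairs n m)" using k 3 unfolding rem_0_def pairs_def by auto
      then show ?thesis by simp
    qed
  qed
  moreover have "?R \<subseteq> ?L"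
  proof
    fix q assume "q \<in> ?R"
    then consider "q \<in> rem_0 (pairs n m)" | "q = {0, 1}" | "b \<noteq> n + 1" "q = {0, b}"
      using b by (auto split: if_splits)
    then have "\<exists>k. q = {k, glue n 0 m k} \<and> 1 \<le> k \<and> k \<le> n"
    proof cases
      case 1
      then obtain k where "1 \<le> k" "k \<le> n" "q = {k, m k}" "1 \<notin> q"
        unfolding rem_0_def pairs_def by auto
      then show ?thesis by (intro exI[of _ k]) (auto simp: g)
    next
      case 2 then show ?thesis using n by (intro exI[of _ 1]) (auto simp: g)
    next
      case 3 then show ?thesis using iv b b1 n by (intro exI[of _ b]) (auto simp: g)
    qed
    then show "q \<in> ?L" unfolding pairs_def by simp
  qed
  ultimately show ?thesis by (rule equalityI)
qed

lemma pairs_glue_n: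
  assumes m: "mate_fun n m" and n: "1 \<le> n" "m n \<noteq> n + 1"
  shows "pairs n (glue n n m) = rem_n n (pairs n m) \<union> {{n, n + 1}} \<union>
    (if m n \<noteq> 0 then {{m n, n + 1}} else {})"
    (is "?L = ?R")
proof -
  obtain b where b: "m n = b" by blast
  have g: "glue n n m k = (if k = n \<or> m k = n then n + 1 else m k)" for k
    using n by (simp add: glue_def)
  have sw: "m k = n \<Longrightarrow> k = b \<and> b \<noteq> 0" for k
    using mate_fun_swap[OF m, of k n] mate_fun_mem_range[OF m, of k n] n b by auto
  have b1: "b \<le> n + 1" "b \<noteq> n" using mate_funD(2,3)[OF m, of n] b n by auto
  have iv: "b \<noteq> 0 \<Longrightarrow> m b = n"
    using mate_funD(4)[OF m, of n] b n b1 by auto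
  have "?L \<subseteq> ?R"
  proof
    fix q assume "q \<in> ?L"
    then obtain k where k: "1 \<le> k" "k \<le> n" "q = {k, glue n n m k}" unfolding pairs_def by auto
    consider "k = n" | "k \<noteq> n" "m k = n" | "k \<noteq> n" "m k \<noteq> n" by blast
    then show "q \<in> ?R"
    proof cases
      case 1 then show ?thesis using k by (auto simp: g insert_commute)
    next
      case 2
      then have "q = {b, n + 1}" "b \<noteq> 0" using k sw[of k] by (auto simp: g insert_commute)
      then show ?thesis using b by simp
    next
      case 3
      then have "q = {k, m k}" using k by (simp add: g)
      then have "q \<in> rem_n n (pairs n m)" using k 3 unfolding rem_n_def pairs_def by auto
      then show ?thesis by simp
    qed
  qed
  moreover have "?R \<subseteq> ?L"
  proof
    fix q assume "q \<in> ?R"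
    then consider "q \<in> rem_n n (pairs n m)" | "q = {n, n + 1}" | "b \<noteq> 0" "q = {b, n + 1}"
      using b by (auto split: if_splits)
    then have "\<exists>k. q = {k, glue n n m k} \<and> 1 \<le> k \<and> k \<le> n"
    proof cases
      case 1
      then obtain k where "1 \<le> k" "k \<le> n" "q = {k, m k}" "n \<notin> q"
        unfolding rem_n_def pairs_def by auto
      then show ?thesis by (intro exI[of _ k]) (auto simp: g)
    next
      case 2 then show ?thesis using n by (intro exI[of _ n]) (auto simp: g)
    next
      case 3 then show ?thesis using iv b b1 n by (intro exI[of _ b]) (auto simp: g)
    qed
    then show "q \<in> ?L" unfolding pairs_def by simp
  qed
  ultimately show ?thesis by (rule equalityI)
qed

definition gen_act :: "nat \<Rightarrow> complex \<Rightarrow> complex \<Rightarrow> complex \<Rightarrow> complex \<Rightarrow> complex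
    \<Rightarrow> nat \<Rightarrow> nat set set \<Rightarrow> cvec" where
  "gen_act n \<delta>0 \<delta> \<delta>n \<beta>0 \<beta>1 i p =
     vsmult (coef n \<delta>0 \<delta> \<delta>n \<beta>0 \<beta>1 i (mates n p)) (basis_vec (pairs n (glue n i (mates n p))))"

lemma vsmult_one: "vsmult 1 v = v" by (simp add: vsmult_def)

lemma act_i_eq_gen_act:
  assumes p: "p \<in> matchings n" and i: "1 \<le> i" "i < n"
  shows "act_i n \<delta>0 \<delta> \<delta>n \<beta>0 \<beta>1 i p = gen_act n \<delta>0 \<delta> \<delta>n \<beta>0 \<beta>1 i p"
proof -
  define m where "m = mates n p"
  have m: "mate_fun n m" unfolding m_def using mate_fun_mates[OF p] .
  have pm: "p = pairs n m" unfolding m_def using pairs_mates[OF p] by simp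
  have mt: "mate p i = m i" "mate p (i + 1) = m (i + 1)" using i by (auto simp: m_def mates_def)
  have le: "m i \<le> n + 1" "m (i + 1) \<le> n + 1" using mate_funD(2)[OF m] by auto
  have C: "coef n \<delta>0 \<delta> \<delta>n \<beta>0 \<beta>1 i m = (if m i = i + 1 then \<delta>
      else if m i = 0 \<and> m (i + 1) = 0 then \<delta>0 ^ pty (i - 1)
      else if m i = n + 1 \<and> m (i + 1) = n + 1 then \<delta>n ^ pty (n + 1 - i)
      else if m i = 0 \<and> m (i + 1) = n + 1 then beta \<beta>0 \<beta>1 (pty i)
      else 1)" using i by (simp add: coef_def)
  show ?thesis
  proof (cases "m i = i + 1")
    case True
    then have "m (i + 1) = i" using mate_fun_swap[OF m, of i "i + 1"] i by simp
    then have "glue n i m = m" using glue_capped[OF m, of i] i True by simp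
    then show ?thesis using True by (simp add: act_i_def gen_act_def mt C flip: m_def pm)
  next
    case False
    note P = pairs_glue_mid[OF m i False, folded pm]
    \<comment> \<open>The prescription has no separate case for mates n + 1 and 0 in this order.
      Such arcs would cross, which makes its list of cases complete.\<close>
    have nc: "\<not> (m i = n + 1 \<and> m (i + 1) = 0)"
      using mate_funD(5)[OF m, of i "i + 1"] i by auto
    consider "1 \<le> m i \<and> m i \<le> n \<or> 1 \<le> m (i + 1) \<and> m (i + 1) \<le> n"
      | "m i = 0" "m (i + 1) = 0" | "m i = 0" "m (i + 1) = n + 1" | "m i = n + 1" "m (i + 1) = n + 1"
      using nc le by linarith
    then show ?thesis
    proof cases
      case 1
      then have "\<not> (m i = 0 \<and> m (i + 1) = 0)" "\<not> (m i = 0 \<and> m (i + 1) = n + 1)" 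
        "\<not> (m i = n + 1 \<and> m (i + 1) = n + 1)" by auto
      then have "act_i n \<delta>0 \<delta> \<delta>n \<beta>0 \<beta>1 i p = basis_vec (rem_i p i \<union> {{i, i + 1}, {m i, m (i + 1)}})"
        "coef n \<delta>0 \<delta> \<delta>n \<beta>0 \<beta>1 i m = 1"
        unfolding act_i_def mt C using False by auto
      moreover have "rem_i p i \<union> {{i, i + 1}, {m i, m (i + 1)}} = pairs n (glue n i m)"
        unfolding P using 1 by auto
      ultimately show ?thesis unfolding gen_act_def m_def[symmetric] by (simp only: vsmult_one)
    next
      case 2
      then show ?thesis unfolding act_i_def gen_act_def m_def[symmetric] mt C P using False by simp
    next
      case 3
      then show ?thesis unfolding act_i_def gen_act_def m_def[symmetric] mt C P using False by simp
    next
      case 4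
      then show ?thesis unfolding act_i_def gen_act_def m_def[symmetric] mt C P using False by simp
    qed
  qed
qed

lemma act_0_eq_gen_act:
  assumes p: "p \<in> matchings n" and n: "1 \<le> n"
  shows "act_0 n \<delta>0 \<beta>0 p = gen_act n \<delta>0 \<delta> \<delta>n \<beta>0 \<beta>1 0 p"
proof -
  define m where "m = mates n p"
  have m: "mate_fun n m" unfolding m_def using mate_fun_mates[OF p] .
  have pm: "p = pairs n m" unfolding m_def using pairs_mates[OF p] by simp
  have mt: "mate p 1 = m 1" using n by (simp add: m_def mates_def)
  have C: "coef n \<delta>0 \<delta> \<delta>n \<beta>0 \<beta>1 0 m = (if m 1 = 0 then \<delta>0 else if m 1 = n + 1 then \<beta>0 else 1)"
    by (simp add: coef_def)
  show ?thesis
  proof (cases "m 1 = 0")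
    case True
    then have "glue n 0 m = m" using glue_0_capped[OF m _ n] by simp
    then show ?thesis unfolding act_0_def gen_act_def m_def[symmetric] mt C
      using True by (simp flip: pm)
  next
    case False
    note P = pairs_glue_0[OF m n False, folded pm]
    show ?thesis unfolding act_0_def gen_act_def m_def[symmetric] mt C P
      using False by (simp add: vsmult_one insert_commute)
  qed
qed

lemma act_n_eq_gen_act:
  assumes p: "p \<in> matchings n" and n: "1 \<le> n"
  shows "act_n n \<delta>n \<beta>0 \<beta>1 p = gen_act n \<delta>0 \<delta> \<delta>n \<beta>0 \<beta>1 n p"
proof -
  define m where "m = mates n p"
  have m: "mate_fun n m" unfolding m_def using mate_fun_mates[OF p] .
  have pm: "p = pairs n m" unfolding m_def using pairs_mates[OF p] by simp
  have mt: "mate p n = m n" using n by (simp add: m_def mates_def)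
  have C: "coef n \<delta>0 \<delta> \<delta>n \<beta>0 \<beta>1 n m
    = (if m n = n + 1 then \<delta>n else if m n = 0 then beta \<beta>0 \<beta>1 (pty n) else 1)"
    using n by (simp add: coef_def)
  show ?thesis
  proof (cases "m n = n + 1")
    case True
    then have "glue n n m = m" using glue_n_capped[OF m _ n] by simp
    then show ?thesis unfolding act_n_def gen_act_def m_def[symmetric] mt C
      using True by (simp flip: pm)
  next
    case False
    note P = pairs_glue_n[OF m n False, folded pm]
    show ?thesis unfolding act_n_def gen_act_def m_def[symmetric] mt C P
      using False by (simp add: vsmult_one insert_commute)
  qed
qed

section \<open>Linear extension and the free algebra\<close>

lemma finite_matchings: "finite (matchings n)"
proof -
  have "S_pairs n \<subseteq> Pow {..n + 1}" by (auto simp: S_pairs_def)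
  then have "finite (S_pairs n)" by (rule finite_subset) simp
  moreover have "matchings n \<subseteq> Pow (S_pairs n)" by (auto simp: matchings_def)
  ultimately show ?thesis by (meson finite_Pow_iff finite_subset)
qed

lemma Vsp_simps [simp]:
  "u \<in> Vsp n \<Longrightarrow> v \<in> Vsp n \<Longrightarrow> vadd u v \<in> Vsp n"
  "v \<in> Vsp n \<Longrightarrow> vsmult c v \<in> Vsp n"
  "(\<lambda>q. 0) \<in> Vsp n"
  "p \<in> matchings n \<Longrightarrow> basis_vec p \<in> Vsp n"
  by (auto simp: Vsp_def vadd_def vsmult_def basis_vec_def) (metis add_cancel_right_left)

lemma Vsp_sum:
  assumes "\<And>w. w \<in> B \<Longrightarrow> g w \<in> Vsp n"
  shows "(\<lambda>q. \<Sum>w\<in>B. c w * g w q) \<in> Vsp n"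
  using assms unfolding Vsp_def
  by (auto elim!: sum.not_neutral_contains_not_neutral)

lemma is_EndD:
  assumes "is_End n f"
  shows "v \<in> Vsp n \<Longrightarrow> f v \<in> Vsp n"
    and "u \<in> Vsp n \<Longrightarrow> v \<in> Vsp n \<Longrightarrow> f (vadd u v) = vadd (f u) (f v)"
    and "v \<in> Vsp n \<Longrightarrow> f (vsmult c v) = vsmult c (f v)"
  using assms unfolding is_End_def by auto

lemma End_zero:
  assumes "is_End n f"
  shows "f (\<lambda>q. 0) = (\<lambda>q. 0)"
  using is_EndD(3)[OF assms, of "\<lambda>q. 0" 0] by (simp add: vsmult_def)

lemma End_sum:
  assumes f: "is_End n f" and "finite B" and "\<And>w. w \<in> B \<Longrightarrow> g w \<in> Vsp n"
  shows "f (\<lambda>q. \<Sum>w\<in>B. c w * g w q) = (\<lambda>q. \<Sum>w\<in>B. c w * f (g w) q)"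
  using assms(2,3)
proof (induction B)
  case empty
  then show ?case using End_zero[OF f] by simp
next
  case (insert x B)
  have "(\<lambda>q. \<Sum>w\<in>insert x B. c w * g w q) = vadd (vsmult (c x) (g x)) (\<lambda>q. \<Sum>w\<in>B. c w * g w q)"
    using insert.hyps by (simp add: vadd_def vsmult_def)
  moreover have "(\<lambda>q. \<Sum>w\<in>B. c w * g w q) \<in> Vsp n"
    using insert.prems by (intro Vsp_sum) auto
  ultimately have "f (\<lambda>q. \<Sum>w\<in>insert x B. c w * g w q)
      = vadd (vsmult (c x) (f (g x))) (f (\<lambda>q. \<Sum>w\<in>B. c w * g w q))"
    using is_EndD[OF f] insert.prems by simp
  then show ?case using insert by (simp add: vadd_def vsmult_def)
qed

lemma Vsp_expand:
  assumes "v \<in> Vsp n"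
  shows "v = (\<lambda>q. \<Sum>p\<in>matchings n. v p * basis_vec p q)"
proof
  fix q
  have "(\<Sum>p\<in>matchings n. v p * basis_vec p q) = (\<Sum>p\<in>matchings n. if p = q then v q else 0)"
    by (rule sum.cong) (auto simp: basis_vec_def)
  also have "\<dots> = v q" using assms finite_matchings[of n] by (auto simp: Vsp_def)
  finally show "v q = (\<Sum>p\<in>matchings n. v p * basis_vec p q)" by simp
qed

lemma End_expand:
  assumes "is_End n f" "v \<in> Vsp n"
  shows "f v = (\<lambda>q. \<Sum>p\<in>matchings n. v p * f (basis_vec p) q)"
proof -
  have "f v = f (\<lambda>q. \<Sum>p\<in>matchings n. v p * basis_vec p q)"
    using Vsp_expand[OF assms(2)] by (rule arg_cong)
  also have "\<dots> = (\<lambda>q. \<Sum>p\<in>matchings n. v p * f (basis_vec p) q)"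
    by (rule End_sum[OF assms(1) finite_matchings]) simp
  finally show ?thesis .
qed

lemma End_eqI:
  assumes "is_End n f" "is_End n g" "v \<in> Vsp n"
    and "\<And>p. p \<in> matchings n \<Longrightarrow> f (basis_vec p) = g (basis_vec p)"
  shows "f v = g v"
  using End_expand[OF assms(1,3)] End_expand[OF assms(2,3)] assms(4) by simp

lemma is_End_comp:
  assumes "is_End n f" "is_End n g"
  shows "is_End n (\<lambda>v. f (g v))"
  using assms unfolding is_End_def by auto

lemma is_End_vsmult:
  assumes "is_End n f"
  shows "is_End n (\<lambda>v. vsmult c (f v))"
  using assms unfolding is_End_def
  by (auto simp: vsmult_def vadd_def Vsp_def algebra_simps)

definition lin_ext :: "nat \<Rightarrow> (nat set set \<Rightarrow> cvec) \<Rightarrow> cvec \<Rightarrow> cvec" where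
  "lin_ext n A v = (\<lambda>q. \<Sum>p\<in>matchings n. v p * A p q)"

lemma is_End_lin_ext:
  assumes "\<And>p. p \<in> matchings n \<Longrightarrow> A p \<in> Vsp n"
  shows "is_End n (lin_ext n A)"
  unfolding is_End_def lin_ext_def using Vsp_sum[of "matchings n" A n] assms
  by (auto simp: vadd_def vsmult_def algebra_simps sum.distrib sum_distrib_left)

lemma lin_ext_basis:
  assumes "p \<in> matchings n"
  shows "lin_ext n A (basis_vec p) = A p"
proof
  fix q
  have "lin_ext n A (basis_vec p) q = (\<Sum>p'\<in>matchings n. if p' = p then A p q else 0)"
    unfolding lin_ext_def by (rule sum.cong) (auto simp: basis_vec_def)
  also have "\<dots> = A p q" using assms finite_matchings[of n] by simp
  finally show "lin_ext n A (basis_vec p) q = A p q" .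
qed

lemma vsmult_vsmult: "vsmult c (vsmult d v) = vsmult (c * d) v"
  by (simp add: vsmult_def mult.assoc)

section \<open>Arithmetic of the free algebra\<close>

text \<open>A nonzero coefficient comes from a cut of the word into two words of the supports.
  Besides closure of \<open>FA n\<close> under products, this provides the finite index set for
  multiplicativity of \<open>phi\<close>.\<close>

lemma fa_mult_support:
  "{w. fa_mult a b w \<noteq> 0} \<subseteq> (\<lambda>(u, x). u @ x) ` ({u. a u \<noteq> 0} \<times> {x. b x \<noteq> 0})"
proof
  fix w assume "w \<in> {w. fa_mult a b w \<noteq> 0}"
  then have "(\<Sum>k\<in>{0..length w}. a (take k w) * b (drop k w)) \<noteq> 0" by (simp add: fa_mult_def)
  then obtain k where "a (take k w) * b (drop k w) \<noteq> 0"
    by (rule sum.not_neutral_contains_not_neutral)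
  then show "w \<in> (\<lambda>(u, x). u @ x) ` ({u. a u \<noteq> 0} \<times> {x. b x \<noteq> 0})"
    by (intro image_eqI[of _ _ "(take k w, drop k w)"]) auto
qed

lemma FA_add: "a \<in> FA n \<Longrightarrow> b \<in> FA n \<Longrightarrow> fa_add a b \<in> FA n"
proof -
  assume ab: "a \<in> FA n" "b \<in> FA n"
  have "{w. fa_add a b w \<noteq> 0} \<subseteq> {w. a w \<noteq> 0} \<union> {w. b w \<noteq> 0}" by (auto simp: fa_add_def)
  then show ?thesis using ab unfolding FA_def by (auto intro: finite_subset)
qed

lemma FA_diff: "a \<in> FA n \<Longrightarrow> b \<in> FA n \<Longrightarrow> fa_diff a b \<in> FA n"
proof -
  assume ab: "a \<in> FA n" "b \<in> FA n"
  have "{w. fa_diff a b w \<noteq> 0} \<subseteq> {w. a w \<noteq> 0} \<union> {w. b w \<noteq> 0}" by (auto simp: fa_diff_def)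
  then show ?thesis using ab unfolding FA_def by (auto intro: finite_subset)
qed

lemma FA_smult: "a \<in> FA n \<Longrightarrow> fa_smult c a \<in> FA n"
proof -
  assume a: "a \<in> FA n"
  have "{w. fa_smult c a w \<noteq> 0} \<subseteq> {w. a w \<noteq> 0}" by (auto simp: fa_smult_def)
  then show ?thesis using a unfolding FA_def by (auto intro: finite_subset)
qed

lemma FA_mult: "a \<in> FA n \<Longrightarrow> b \<in> FA n \<Longrightarrow> fa_mult a b \<in> FA n"
proof -
  assume ab: "a \<in> FA n" "b \<in> FA n"
  have "finite {w. fa_mult a b w \<noteq> 0}"
    using finite_subset[OF fa_mult_support[of a b]] ab unfolding FA_def by auto
  moreover have "set w \<subseteq> {0..n}" if "fa_mult a b w \<noteq> 0" for w
  proof -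
    obtain u x where "w = u @ x" "a u \<noteq> 0" "b x \<noteq> 0" using fa_mult_support[of a b] \<open>fa_mult a b w \<noteq> 0\<close> by auto
    then show ?thesis using ab unfolding FA_def by auto
  qed
  ultimately show ?thesis unfolding FA_def by auto
qed

definition fa_word :: "nat list \<Rightarrow> fa" where
  "fa_word w = (\<lambda>u. if u = w then 1 else 0)"

lemma FA_word: "set w \<subseteq> {0..n} \<Longrightarrow> fa_word w \<in> FA n"
  unfolding FA_def fa_word_def by auto

lemma FA_zero: "fa_zero \<in> FA n"
  by (auto simp: FA_def fa_zero_def)

lemma fa_gen_word: "fa_gen i = fa_word [i]" by (simp add: fa_gen_def fa_word_def)

lemma FA_gen: "i \<le> n \<Longrightarrow> fa_gen i \<in> FA n"
  unfolding fa_gen_word by (rule FA_word) auto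

lemma fa_one_word: "fa_one = fa_word []" by (simp add: fa_one_def fa_word_def)

text \<open>Only the cut after the first letter can have prefix [i]; the empty word has no such cut
  and is treated apart.\<close>

lemma fa_word_Cons: "fa_word (i # w) = fa_mult (fa_gen i) (fa_word w)"
proof
  fix u
  show "fa_word (i # w) u = fa_mult (fa_gen i) (fa_word w) u"
  proof (cases u)
    case Nil
    then show ?thesis by (simp add: fa_word_def fa_mult_def fa_gen_def)
  next
    case (Cons j x)
    have "fa_mult (fa_gen i) (fa_word w) u
      = (\<Sum>k\<in>{0..length u}. if k = 1 then (if u = i # w then 1 else 0) else 0)"
      unfolding fa_mult_def
    proof (rule sum.cong)
      fix k assume "k \<in> {0..length u}"
      then show "fa_gen i (take k u) * fa_word w (drop k u)
          = (if k = 1 then (if u = i # w then 1 else 0) else 0)"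
        using Cons by (cases k) (auto simp: fa_gen_def fa_word_def take_Cons')
    qed simp
    also have "\<dots> = fa_word (i # w) u" using Cons by (auto simp: fa_word_def Suc_le_eq)
    finally show ?thesis by simp
  qed
qed

section \<open>The representation\<close>

locale tl_params =
  fixes n :: nat and \<delta>0 \<delta> \<delta>n \<beta>0 \<beta>1 :: complex
  assumes n1: "1 \<le> n"
begin

abbreviation "cf \<equiv> coef n \<delta>0 \<delta> \<delta>n \<beta>0 \<beta>1"

definition E :: "nat \<Rightarrow> cvec \<Rightarrow> cvec" where
  "E i = lin_ext n (gen_act n \<delta>0 \<delta> \<delta>n \<beta>0 \<beta>1 i)"

lemma is_End_E:
  assumes "i \<le> n"
  shows "is_End n (E i)"
  unfolding E_def
proof (rule is_End_lin_ext)
  fix p assume "p \<in> matchings n"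
  then have "pairs n (glue n i (mates n p)) \<in> matchings n"
    using pairs_in_matchings mate_fun_glue mate_fun_mates n1 assms by blast
  then show "gen_act n \<delta>0 \<delta> \<delta>n \<beta>0 \<beta>1 i p \<in> Vsp n" by (simp add: gen_act_def)
qed

lemma E_basis: "p \<in> matchings n \<Longrightarrow> E i (basis_vec p) = gen_act n \<delta>0 \<delta> \<delta>n \<beta>0 \<beta>1 i p"
  unfolding E_def by (rule lin_ext_basis)

lemma E_pairs:
  assumes m: "mate_fun n m" and i: "i \<le> n"
  shows "E i (vsmult c (basis_vec (pairs n m))) = vsmult (c * cf i m) (basis_vec (pairs n (glue n i m)))"
  using is_EndD(3)[OF is_End_E[OF i]] pairs_in_matchings[OF m]
  by (simp add: E_basis gen_act_def mates_pairs[OF m] vsmult_vsmult)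

lemma E_pairs_basis:
  assumes m: "mate_fun n m" and i: "i \<le> n"
  shows "E i (basis_vec (pairs n m)) = vsmult (cf i m) (basis_vec (pairs n (glue n i m)))"
  using E_pairs[OF assms, of 1] by (simp add: vsmult_one)

lemma E_square:
  assumes i: "i \<le> n" and v: "v \<in> Vsp n"
  shows "E i (E i v) = vsmult (dlt n \<delta>0 \<delta> \<delta>n i) (E i v)"
proof (rule End_eqI[OF _ _ v, where f = "\<lambda>v. E i (E i v)" and g = "\<lambda>v. vsmult (dlt n \<delta>0 \<delta> \<delta>n i) (E i v)"])
  show "is_End n (\<lambda>v. E i (E i v))" "is_End n (\<lambda>v. vsmult (dlt n \<delta>0 \<delta> \<delta>n i) (E i v))"
    using is_End_E[OF i] is_End_comp is_End_vsmult by auto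
  fix p assume p: "p \<in> matchings n"
  define m where "m = mates n p"
  have m: "mate_fun n m" and pm: "p = pairs n m"
    unfolding m_def using mate_fun_mates[OF p] pairs_mates[OF p] by auto
  show "E i (E i (basis_vec p)) = vsmult (dlt n \<delta>0 \<delta> \<delta>n i) (E i (basis_vec p))"
    unfolding pm using m i n1
    by (simp add: E_pairs E_pairs_basis mate_fun_glue glue_idem coef_glue_same vsmult_vsmult mult.commute)
qed

lemma E_TL:
  assumes i: "1 \<le> i" "i < n" "j = i + 1 \<or> j + 1 = i" and v: "v \<in> Vsp n"
  shows "E i (E j (E i v)) = E i v"
proof (rule End_eqI[OF _ _ v, where f = "\<lambda>v. E i (E j (E i v))" and g = "E i"])
  have ij: "i \<le> n" "j \<le> n" using i by auto
  show "is_End n (\<lambda>v. E i (E j (E i v)))" "is_End n (E i)"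
    using is_End_comp[OF is_End_E[OF ij(1)] is_End_comp[OF is_End_E[OF ij(2)] is_End_E[OF ij(1)]]]
      is_End_E[OF ij(1)] by auto
  fix p assume p: "p \<in> matchings n"
  define m where "m = mates n p"
  have m: "mate_fun n m" and pm: "p = pairs n m"
    unfolding m_def using mate_fun_mates[OF p] pairs_mates[OF p] by auto
  \<comment> \<open>On m' the product \<open>E i (E j _)\<close> acts as the identity with scalar 1,
    so only the scalar of the first application of \<open>E i\<close> remains, as on the right-hand
    side.\<close>
  define m' where "m' = glue n i m"
  have m': "mate_fun n m'" "m' i = i + 1" "m' (i + 1) = i"
    unfolding m'_def using mate_fun_glue[OF m n1 ij(1)] glue_caps i by auto
  show "E i (E j (E i (basis_vec p))) = E i (basis_vec p)"
    unfolding pm using m m' ij n1 glue_glue_capped[OF m'(1) i(1,2) m'(2,3) i(3)]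
      coef_glue_glue_capped[OF m'(1) i(1,2) m'(2,3) i(3)]
    by (simp add: E_pairs E_pairs_basis mate_fun_glue flip: m'_def)
qed

lemma E_comm:
  assumes ij: "i + 1 < j" "j \<le> n" and v: "v \<in> Vsp n"
  shows "E i (E j v) = E j (E i v)"
proof (rule End_eqI[OF _ _ v, where f = "\<lambda>v. E i (E j v)" and g = "\<lambda>v. E j (E i v)"])
  have i: "i \<le> n" using ij by auto
  show "is_End n (\<lambda>v. E i (E j v))" "is_End n (\<lambda>v. E j (E i v))"
    using is_End_E[OF i] is_End_E[OF ij(2)] is_End_comp by auto
  fix p assume p: "p \<in> matchings n"
  define m where "m = mates n p"
  have m: "mate_fun n m" and pm: "p = pairs n m"
    unfolding m_def using mate_fun_mates[OF p] pairs_mates[OF p] by auto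
  show "E i (E j (basis_vec p)) = E j (E i (basis_vec p))"
    unfolding pm using m i ij n1 glue_comm[OF m ij] coef_comm[OF m ij]
    by (simp add: E_pairs E_pairs_basis mate_fun_glue)
qed

section \<open>Evaluation of the free algebra at the operators \<open>E i\<close>\<close>

fun word_op :: "nat list \<Rightarrow> cvec \<Rightarrow> cvec" where
  "word_op [] v = v"
| "word_op (i # w) v = E i (word_op w v)"

lemma is_End_word_op: "set w \<subseteq> {0..n} \<Longrightarrow> is_End n (word_op w)"
proof (induction w)
  case Nil
  then show ?case by (simp add: is_End_def)
next
  case (Cons i w)
  then show ?case using is_End_comp[OF is_End_E[of i], of "word_op w"] by (simp add: is_End_def)
qed

lemma word_op_append: "word_op (u @ w) v = word_op u (word_op w v)"
  by (induction u) auto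

definition phi :: "fa \<Rightarrow> cvec \<Rightarrow> cvec" where
  "phi a v = (\<lambda>q. \<Sum>w | a w \<noteq> 0. a w * word_op w v q)"

text \<open>Supports may shrink under sums, scalar multiples and products. Padding with zero terms
  puts all the sums to be compared over one index set.\<close>

lemma phi_superset:
  assumes "finite C" "{w. a w \<noteq> 0} \<subseteq> C"
  shows "phi a v q = (\<Sum>w\<in>C. a w * word_op w v q)"
  unfolding phi_def using assms by (intro sum.mono_neutral_left) auto

lemma is_End_phi:
  assumes a: "a \<in> FA n"
  shows "is_End n (phi a)"
proof -
  have w: "is_End n (word_op w)" if "w \<in> {w. a w \<noteq> 0}" for w
    using a that is_End_word_op unfolding FA_def by auto
  have "phi a v \<in> Vsp n" if "v \<in> Vsp n" for v
    unfolding phi_def using is_EndD(1)[OF w] that by (intro Vsp_sum) auto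
  moreover have "phi a (vadd u v) = vadd (phi a u) (phi a v)" if "u \<in> Vsp n" "v \<in> Vsp n" for u v
    unfolding phi_def using is_EndD(2)[OF w] that
    by (simp add: vadd_def sum.distrib[symmetric] algebra_simps)
  moreover have "phi a (vsmult c v) = vsmult c (phi a v)" if "v \<in> Vsp n" for c v
    unfolding phi_def using is_EndD(3)[OF w] that
    by (simp add: vsmult_def sum_distrib_left algebra_simps)
  ultimately show ?thesis unfolding is_End_def by blast
qed

lemma phi_word: "phi (fa_word w) v = word_op w v"
  using phi_superset[of "{w}" "fa_word w" v] by (auto simp: fa_word_def)

lemma phi_add:
  assumes "a \<in> FA n" "b \<in> FA n"
  shows "phi (fa_add a b) v = vadd (phi a v) (phi b v)"
proof
  fix q
  let ?C = "{w. a w \<noteq> 0} \<union> {w. b w \<noteq> 0}"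
  have C: "finite ?C" using assms unfolding FA_def by auto
  have sub: "{w. a w \<noteq> 0} \<subseteq> ?C" "{w. b w \<noteq> 0} \<subseteq> ?C" "{w. fa_add a b w \<noteq> 0} \<subseteq> ?C"
    by (auto simp: fa_add_def)
  show "phi (fa_add a b) v q = vadd (phi a v) (phi b v) q"
    unfolding vadd_def phi_superset[OF C sub(1)] phi_superset[OF C sub(2)] phi_superset[OF C sub(3)]
    by (simp add: fa_add_def sum.distrib algebra_simps)
qed

lemma phi_smult:
  assumes "a \<in> FA n"
  shows "phi (fa_smult c a) v = vsmult c (phi a v)"
proof
  fix q
  let ?C = "{w. a w \<noteq> 0}"
  have C: "finite ?C" using assms unfolding FA_def by auto
  show "phi (fa_smult c a) v q = vsmult c (phi a v) q"
    using phi_superset[OF C, of a v q] phi_superset[OF C, of "fa_smult c a" v q]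
    by (auto simp: fa_smult_def vsmult_def sum_distrib_left algebra_simps)
qed

lemma phi_diff:
  assumes "a \<in> FA n" "b \<in> FA n"
  shows "phi (fa_diff a b) v = (\<lambda>q. phi a v q - phi b v q)"
proof -
  have "fa_diff a b = fa_add a (fa_smult (- 1) b)" by (simp add: fa_diff_def fa_add_def fa_smult_def)
  then show ?thesis using assms by (simp add: phi_add phi_smult FA_smult vadd_def vsmult_def)
qed

text \<open>The convolution runs over words with a cut position, the composite over pairs of words.
  Cutting and concatenating are inverse to each other, so the sum can be reindexed.\<close>

lemma phi_mult:
  assumes a: "a \<in> FA n" and b: "b \<in> FA n" and v: "v \<in> Vsp n"
  shows "phi (fa_mult a b) v = phi a (phi b v)"
proof
  fix q
  let ?A = "{w. a w \<noteq> 0}" and ?B = "{w. b w \<noteq> 0}"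
  have fin: "finite ?A" "finite ?B" using a b unfolding FA_def by auto
  \<comment> \<open>All concatenations of support words: finite, and by
    \<open>fa_mult_support\<close> large enough to contain the support of the product.\<close>
  define C where "C = (\<lambda>(u, x). u @ x) ` (?A \<times> ?B)"
  have C: "finite C" unfolding C_def using fin by auto
  define h where "h = (\<lambda>(u, x). a u * b x * word_op (u @ x) v q)"
  define T where "T = (SIGMA w:C. {0..length w})"
  define s where "s = (\<lambda>(w :: nat list, k). (take k w, drop k w))"
  have inj: "inj_on s T"
  proof (rule inj_onI, clarify)
    fix w k w' k' assume T: "(w, k) \<in> T" "(w', k') \<in> T" and eq: "s (w, k) = s (w', k')"
    then have t: "take k w = take k' w'" "drop k w = drop k' w'" by (auto simp: s_def)
    then have "w = w'" by (metis append_take_drop_id)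
    moreover have "length (take k w) = k" "length (take k' w') = k'" using T by (auto simp: T_def)
    ultimately show "w = w' \<and> k = k'" using t by metis
  qed
  have sub: "?A \<times> ?B \<subseteq> s ` T"
  proof (clarify)
    fix u x assume "a u \<noteq> 0" "b x \<noteq> 0"
    then have "(u @ x, length u) \<in> T" by (auto simp: T_def C_def)
    then show "(u, x) \<in> s ` T" by (rule rev_image_eqI) (simp add: s_def)
  qed
  have "phi (fa_mult a b) v q = (\<Sum>w\<in>C. fa_mult a b w * word_op w v q)"
    by (rule phi_superset[OF C]) (use fa_mult_support[of a b] in \<open>simp add: C_def\<close>)
  also have "\<dots> = (\<Sum>w\<in>C. \<Sum>k\<in>{0..length w}. h (s (w, k)))"
    by (simp add: fa_mult_def sum_distrib_right h_def s_def)
  also have "\<dots> = sum (h \<circ> s) T"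
    unfolding T_def using C by (subst sum.Sigma) (auto intro: sum.cong)
  also have "\<dots> = sum h (s ` T)" using sum.reindex[OF inj, of h] by simp
  \<comment> \<open>Words in C may also be cut into parts outside the two supports; there a
    coefficient in h vanishes.\<close>
  also have "\<dots> = sum h (?A \<times> ?B)"
    by (rule sum.mono_neutral_right[OF _ sub]) (use C in \<open>auto simp: T_def h_def\<close>)
  also have "\<dots> = (\<Sum>u\<in>?A. \<Sum>x\<in>?B. h (u, x))" using fin by (simp add: sum.cartesian_product)
  also have "\<dots> = (\<Sum>u\<in>?A. a u * word_op u (phi b v) q)"
  proof (rule sum.cong)
    fix u assume u: "u \<in> ?A"
    have Eu: "is_End n (word_op u)" using a u is_End_word_op unfolding FA_def by auto
    have Vx: "word_op x v \<in> Vsp n" if "x \<in> ?B" for x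
      using b that is_EndD(1)[OF is_End_word_op v] unfolding FA_def by auto
    have "word_op u (phi b v) = (\<lambda>q. \<Sum>x\<in>?B. b x * word_op u (word_op x v) q)"
      unfolding phi_def using End_sum[OF Eu fin(2), of "\<lambda>x. word_op x v" b] Vx by simp
    then show "(\<Sum>x\<in>?B. h (u, x)) = a u * word_op u (phi b v) q"
      by (simp add: h_def word_op_append sum_distrib_left mult.assoc)
  qed simp
  finally show "phi (fa_mult a b) v q = phi a (phi b v) q" by (simp add: phi_def)
qed

lemma phi_gen: "phi (fa_gen i) v = E i v"
  unfolding fa_gen_word phi_word by simp

lemma phi_rel:
  assumes "r \<in> TL_rels n \<delta>0 \<delta> \<delta>n"
  shows "r \<in> FA n \<and> (\<forall>v\<in>Vsp n. phi r v = (\<lambda>q. 0))"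
proof -
  have E: "E i v \<in> Vsp n" if "i \<le> n" "v \<in> Vsp n" for i v using is_EndD(1)[OF is_End_E] that by auto
  note S = FA_gen FA_mult FA_diff FA_smult phi_gen phi_mult phi_diff phi_smult E
  consider (sq) i where "i \<le> n"
      "r = fa_diff (fa_mult (fa_gen i) (fa_gen i)) (fa_smult (dlt n \<delta>0 \<delta> \<delta>n i) (fa_gen i))"
    | (tl) i j where "1 \<le> i" "i < n" "j = i + 1 \<or> j + 1 = i"
      "r = fa_diff (fa_mult (fa_mult (fa_gen i) (fa_gen j)) (fa_gen i)) (fa_gen i)"
    | (com) i j where "i \<le> n" "j \<le> n" "i + 1 < j \<or> j + 1 < i"
      "r = fa_diff (fa_mult (fa_gen i) (fa_gen j)) (fa_mult (fa_gen j) (fa_gen i))"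
    using assms unfolding TL_rels_def by blast
  then show ?thesis
  proof cases
    case sq
    then show ?thesis using E_square[of i] by (simp add: S)
  next
    case tl
    then have "i \<le> n" "j \<le> n" by auto
    then show ?thesis using E_TL[OF tl(1-3)] tl(4) by (simp add: S)
  next
    case com
    then have "E i (E j v) = E j (E i v)" if "v \<in> Vsp n" for v
      using E_comm[of i j v] E_comm[of j i v] that by auto
    then show ?thesis using com by (simp add: S)
  qed
qed

text \<open>A summand a r b acts through the relation r on \<open>phi b v\<close>, which again lies
  in C[M], and hence acts as zero.\<close>

lemma phi_ideal:
  assumes "x \<in> TL_ideal n \<delta>0 \<delta> \<delta>n"
  shows "x \<in> FA n \<and> (\<forall>v\<in>Vsp n. phi x v = (\<lambda>q. 0))"
  using assms
proof induction
  case zero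
  then show ?case using FA_zero by (auto simp: phi_def fa_zero_def)
next
  case (step r a b x)
  have r: "r \<in> FA n" "\<And>v. v \<in> Vsp n \<Longrightarrow> phi r v = (\<lambda>q. 0)" using phi_rel[OF step.hyps(1)] by auto
  have "phi b v \<in> Vsp n" if "v \<in> Vsp n" for v using is_EndD(1)[OF is_End_phi[OF step.hyps(3)]] that by auto
  then show ?case
    using step r by (simp add: FA_add FA_mult phi_add phi_mult End_zero[OF is_End_phi] vadd_def)
qed

section \<open>Descent to the quotient and uniqueness\<close>

text \<open>The representative is arbitrary. Its choice is invisible on C[M], where two
  representatives differ by an element of the ideal; outside C[M] no value is prescribed.\<close>

definition omega :: "fa set \<Rightarrow> cvec \<Rightarrow> cvec" where
  "omega X = phi (SOME x. x \<in> X)"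

abbreviation "clas \<equiv> cls n \<delta>0 \<delta> \<delta>n"

text \<open>The class is nonempty because x - x = 0 lies in the ideal, so the chosen element is a
  genuine representative.\<close>

lemma some_in_cls:
  assumes "x \<in> FA n"
  shows "(SOME y. y \<in> clas x) \<in> FA n" and "fa_diff x (SOME y. y \<in> clas x) \<in> TL_ideal n \<delta>0 \<delta> \<delta>n"
proof -
  have "fa_diff x x = fa_zero" by (simp add: fa_diff_def fa_zero_def)
  then have "x \<in> clas x" using assms TL_ideal.zero by (simp add: cls_def TL_cong_def)
  then have "(SOME y. y \<in> clas x) \<in> clas x" by (rule someI[of "\<lambda>y. y \<in> clas x"])
  then show "(SOME y. y \<in> clas x) \<in> FA n" "fa_diff x (SOME y. y \<in> clas x) \<in> TL_ideal n \<delta>0 \<delta> \<delta>n"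
    by (auto simp: cls_def TL_cong_def)
qed

lemma omega_cls:
  assumes x: "x \<in> FA n" and v: "v \<in> Vsp n"
  shows "omega (clas x) v = phi x v"
proof -
  have "(\<lambda>q. phi x v q - omega (clas x) v q) = (\<lambda>q. 0)"
    using phi_ideal[OF some_in_cls(2)[OF x]] v phi_diff[OF x some_in_cls(1)[OF x]]
    unfolding omega_def by simp
  then show ?thesis by (simp add: fun_eq_iff)
qed

lemma TL_cls:
  assumes "X \<in> TL n \<delta>0 \<delta> \<delta>n"
  obtains x where "x \<in> FA n" "X = clas x"
  using assms unfolding TL_def cls_def by (auto elim: quotientE)

lemma cls_in_TL: "x \<in> FA n \<Longrightarrow> clas x \<in> TL n \<delta>0 \<delta> \<delta>n"
  unfolding TL_def cls_def by (rule quotientI)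

lemma is_TL_hom_omega: "is_TL_hom n \<delta>0 \<delta> \<delta>n omega"
  unfolding is_TL_hom_def
proof (intro conjI ballI allI)
  fix X assume "X \<in> TL n \<delta>0 \<delta> \<delta>n"
  then obtain x where "x \<in> FA n" "X = clas x" by (rule TL_cls)
  then show "is_End n (omega X)" unfolding omega_def using is_End_phi some_in_cls(1) by simp
next
  fix v assume "v \<in> Vsp n"
  then show "omega (clas fa_one) v = v" 
    using omega_cls[of fa_one v] FA_word[of "[]" n] by (simp add: fa_one_word phi_word)
next
  fix x y v assume *: "x \<in> FA n" "y \<in> FA n" "v \<in> Vsp n"
  then have "phi y v \<in> Vsp n" using is_EndD(1)[OF is_End_phi] by blast
  then show "omega (clas (fa_mult x y)) v = omega (clas x) (omega (clas y) v)"
    using * by (simp add: omega_cls FA_mult phi_mult)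
qed (simp_all add: omega_cls FA_add FA_smult phi_add phi_smult)

text \<open>The indices 0, ..., n are the interior ones together with 0 and n, so the three
  displayed formulas merge into one; for n = 1 there are no interior indices.\<close>

lemma acts_as_prescribed_iff:
  "acts_as_prescribed n \<delta>0 \<delta> \<delta>n \<beta>0 \<beta>1 \<omega> \<longleftrightarrow>
    (\<forall>p\<in>matchings n. \<forall>i\<le>n. \<omega> (clas (fa_gen i)) (basis_vec p) = gen_act n \<delta>0 \<delta> \<delta>n \<beta>0 \<beta>1 i p)"
proof -
  have "(\<forall>i\<le>n. P i) \<longleftrightarrow> (\<forall>i. 1 \<le> i \<and> i < n \<longrightarrow> P i) \<and> P 0 \<and> P n" for P
    by (metis le0 le_eq_less_or_eq less_one not_less order_refl)
  then show ?thesis unfolding acts_as_prescribed_def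
    using act_i_eq_gen_act act_0_eq_gen_act[OF _ n1] act_n_eq_gen_act[OF _ n1] by (intro ball_cong refl) simp
qed

lemma acts_as_prescribed_omega: "acts_as_prescribed n \<delta>0 \<delta> \<delta>n \<beta>0 \<beta>1 omega"
  unfolding acts_as_prescribed_iff by (simp add: omega_cls FA_gen phi_gen E_basis)

text \<open>This is uniqueness: agreement on basis vectors extends to C[M] by linearity for each
  generator, to words by multiplicativity, and to all of \<open>FA n\<close> by removing one word at
  a time from the support.\<close>

lemma hom_eq_phi:
  assumes hom: "is_TL_hom n \<delta>0 \<delta> \<delta>n \<omega>" and act: "acts_as_prescribed n \<delta>0 \<delta> \<delta>n \<beta>0 \<beta>1 \<omega>"
    and x: "x \<in> FA n" and v: "v \<in> Vsp n"
  shows "\<omega> (clas x) v = phi x v"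
proof -
  have h_end: "is_End n (\<omega> (clas x))" if "x \<in> FA n" for x
    using hom cls_in_TL[OF that] unfolding is_TL_hom_def by blast
  have h_add: "\<omega> (clas (fa_add x y)) v = vadd (\<omega> (clas x) v) (\<omega> (clas y) v)"
    and h_mult: "\<omega> (clas (fa_mult x y)) v = \<omega> (clas x) (\<omega> (clas y) v)"
    if "x \<in> FA n" "y \<in> FA n" "v \<in> Vsp n" for x y v
    using hom that unfolding is_TL_hom_def by blast+
  have h_smult: "\<omega> (clas (fa_smult c x)) v = vsmult c (\<omega> (clas x) v)"
    if "x \<in> FA n" "v \<in> Vsp n" for c x v
    using hom that unfolding is_TL_hom_def by blast
  have h_one: "\<omega> (clas fa_one) v = v" if "v \<in> Vsp n" for v
    using hom that unfolding is_TL_hom_def by blast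
  have gen: "\<omega> (clas (fa_gen i)) v = E i v" if "i \<le> n" "v \<in> Vsp n" for i v
  proof (rule End_eqI[OF h_end[OF FA_gen[OF that(1)]] is_End_E[OF that(1)] that(2)])
    fix p assume "p \<in> matchings n"
    then show "\<omega> (clas (fa_gen i)) (basis_vec p) = E i (basis_vec p)"
      using act that(1) by (simp add: acts_as_prescribed_iff E_basis)
  qed
  have word: "\<omega> (clas (fa_word w)) v = word_op w v" if "set w \<subseteq> {0..n}" for w
    using that
  proof (induction w)
    case Nil
    then show ?case using h_one[OF v] by (simp add: fa_one_word)
  next
    case (Cons i w)
    then have i: "i \<le> n" and w: "set w \<subseteq> {0..n}" by auto
    have "word_op w v \<in> Vsp n" using is_EndD(1)[OF is_End_word_op[OF w] v] .
    then show ?case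
      using Cons.IH[OF w] h_mult[OF FA_gen[OF i] FA_word[OF w] v] gen[OF i] by (simp add: fa_word_Cons)
  qed
  have "\<omega> (clas a) v = phi a v" if "finite S" "{w. a w \<noteq> 0} = S" "a \<in> FA n" for S a
    using that
  proof (induction S arbitrary: a)
    case empty
    \<comment> \<open>Here a is the zero element; writing it as 0 times itself lets the clause on
      scalars yield the value 0.\<close>
    then have a: "a = fa_smult 0 a" by (auto simp: fa_smult_def)
    have "vsmult 0 (\<omega> (clas a) v) = vsmult 0 (phi a v)" by (simp add: vsmult_def)
    then have "\<omega> (clas (fa_smult 0 a)) v = phi (fa_smult 0 a) v"
      using h_smult[OF empty.prems(2) v, of 0] phi_smult[OF empty.prems(2), of 0 v] by simp
    then show ?case unfolding a[symmetric] .
  next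
    case (insert w S)
    define a' where "a' = a(w := 0)"
    have w: "set w \<subseteq> {0..n}" using insert.prems unfolding FA_def by auto
    have a'S: "{u. a' u \<noteq> 0} = S" using insert.hyps(2) insert.prems(1) by (auto simp: a'_def)
    have a': "a' \<in> FA n" using insert.prems(2) a'S insert.hyps(1) unfolding FA_def by (auto simp: a'_def)
    have aw: "fa_smult (a w) (fa_word w) \<in> FA n" using FA_smult[OF FA_word[OF w]] .
    have a: "a = fa_add (fa_smult (a w) (fa_word w)) a'"
      by (auto simp: fa_add_def fa_smult_def fa_word_def a'_def)
    have "\<omega> (clas (fa_add (fa_smult (a w) (fa_word w)) a')) v
        = phi (fa_add (fa_smult (a w) (fa_word w)) a') v"
      using h_add[OF aw a' v] phi_add[OF aw a'] insert.IH[OF a'S a'] word[OF w]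
        h_smult[OF FA_word[OF w] v] phi_smult[OF FA_word[OF w]] phi_word by simp
    then show ?case using a by metis
  qed
  then show ?thesis using x unfolding FA_def by blast
qed

end

theorem mainTheorem3:
  fixes n :: nat and \<delta>0 \<delta> \<delta>n \<beta>0 \<beta>1 :: complex
  assumes "1 \<le> n"
    and "\<delta>0 \<noteq> 0" and "\<delta> \<noteq> 0" and "\<delta>n \<noteq> 0" and "\<beta>0 \<noteq> 0" and "\<beta>1 \<noteq> 0"
  shows "\<exists>\<omega>. is_TL_hom n \<delta>0 \<delta> \<delta>n \<omega> \<and> acts_as_prescribed n \<delta>0 \<delta> \<delta>n \<beta>0 \<beta>1 \<omega>
           \<and> (\<forall>\<omega>'. is_TL_hom n \<delta>0 \<delta> \<delta>n \<omega>' \<and> acts_as_prescribed n \<delta>0 \<delta> \<delta>n \<beta>0 \<beta>1 \<omega>'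
                  \<longrightarrow> (\<forall>X \<in> TL n \<delta>0 \<delta> \<delta>n. \<forall>v \<in> Vsp n. \<omega>' X v = \<omega> X v))"
proof -
  interpret tl_params n \<delta>0 \<delta> \<delta>n \<beta>0 \<beta>1 by unfold_locales fact
  have "\<omega>' X v = omega X v"
    if "is_TL_hom n \<delta>0 \<delta> \<delta>n \<omega>'" "acts_as_prescribed n \<delta>0 \<delta> \<delta>n \<beta>0 \<beta>1 \<omega>'"
      and "X \<in> TL n \<delta>0 \<delta> \<delta>n" and v: "v \<in> Vsp n" for \<omega>' X v
  proof -
    obtain x where x: "x \<in> FA n" "X = clas x" using TL_cls \<open>X \<in> _\<close> by blast
    then show ?thesis using hom_eq_phi[OF that(1,2) x(1) v] omega_cls[OF x(1) v] by simp
  qed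
  then show ?thesis using is_TL_hom_omega acts_as_prescribed_omega by blast
qed

end
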